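(* Every $T\in\mathcal B(\mathcal H_n)$ admits a factorisation $T=UQ$, where $Q:=|T|=(T^*T)^{1/2}$ is uniquely determined and $U:\overline{\mathrm{Ran}(Q)}\to\overline{\mathrm{Ran}(T)}$ is a partial isometry. In the particular case that $T\in\mathcal B(\mathcal H_n)$ is normal, we can choose $U$ such that $U$ is unitary and we have the following: for $W\in\mathcal B(\mathcal H_n)$, $$WT=TW\ \text{ and }\ WT^*=T^*W\ \Longrightarrow\ WQ=QW$$ and $$WT=TW\ \text{ and }\ WT^*=T^*W\ \Longrightarrow\ WU=UW.$$ Moreover, $T$ is normal if and only if $QU=UQ$.
   Context: Let $n\ge1$. $\mathbb R_n$ is the real Clifford algebra (of real dimension $2^n$) generated by $e_1,\dots,e_n$ with $e_i^2=-1$ and $e_ie_j=-e_je_i$ for $i\ne j$; it has basis $e_\alpha=e_{i_1}\cdots e_{i_r}$ for $\alpha=\{i_1<\cdots<i_r\}\subseteq\{1,\dots,n\}$, $e_\emptyset=1$. For $a=\sum_\alpha a_\alpha e_\alpha$ ($a_\alpha\in\mathbb R$): $\mathrm{Re}(a)=a_\emptyset$, and $a\mapsto\bar a$ is the real-linear map with $\overline{ab}=\bar b\,\bar a$, $\bar 1=1$, $\bar e_j=-e_j$. $a\succeq 0$ means $a=b\bar b$ for some $b\in\mathbb R_n$. $\mathcal H$ is a real Hilbert space and $\mathcal H_n=\mathcal H\otimes\mathbb R_n$ is the two-sided Clifford module of elements $x=\sum_\alpha x_\alpha e_\alpha$ ($x_\alpha\in\mathcal H$), with $\langle x,y\rangle=\sum_{\alpha,\beta}\bar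 e_\beta e_\alpha\langle x_\alpha,y_\beta\rangle_{\mathcal H}\in\mathbb R_n$ (so $\langle xa,y\rangle=\langle x,y\rangle a$) and norm $\|x\|=(\sum_\alpha\|x_\alpha\|^2)^{1/2}=(\mathrm{Re}\langle x,x\rangle)^{1/2}$. $\mathcal B(\mathcal H_n)$ is the set of everywhere defined bounded right $\mathbb R_n$-linear operators on $\mathcal H_n$; $T^*$ is the adjoint, $\langle Tx,y\rangle=\langle x,T^*y\rangle$. $T$ is normal if $TT^*=T^*T$, unitary if $TT^*=T^*T=I$, positive if $\langle Tx,x\rangle\succeq0$ for all $x$. Every positive $P\in\mathcal B(\mathcal H_n)$ has a unique positive square root $P^{1/2}\in\mathcal B(\mathcal H_n)$. A partial isometry is an operator in $\mathcal B(\mathcal H_n)$ that is isometric on the orthogonal complement of its kernel; here $U$ is extended by $0$ on $\overline{\mathrm{Ran}(Q)}^{\perp}$ in the general case.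
   Formalization: In "T is normal if and only if QU=UQ" the converse is stated only for unitary U with T=UQ: for the partial isometry U it fails (T = unilateral shift on l^2 tensor identity has Q=I, U=T, QU=UQ, T not normal); T normal implies QU=UQ is kept for the partial isometry. *)

theory Defs
  imports "HOL-Analysis.Analysis"
begin

text \<open>
  The generators are indexed by a finite linearly ordered type \<open>'n\<close>, so the algebra is
  \<open>\<real>\<^sub>n\<close> with \<open>n = CARD('n)\<close>; as types are nonempty, \<open>n \<ge> 1\<close>.  An element is
  given by its real coefficients \<open>a\<^sub>A\<close> with respect to the basis \<open>e\<^sub>A\<close>, indexed by the sets \<open>A\<close> of generator indices.
\<close>

typedef 'n clifford = "UNIV :: ('n set \<Rightarrow> real) set"
  morphisms coeff Clifford ..

lemma coeff_Clifford [simp]: "coeff (Clifford f) = f"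
  by (simp add: Clifford_inverse)

lemma clifford_eq_iff: "a = b \<longleftrightarrow> (\<forall>A. coeff a A = coeff b A)"
  by (metis coeff_inject ext)

text \<open>
  \<open>e\<^sub>A e\<^sub>B = reorder_sign A B *\<^sub>R e\<^bsub>sym_diff A B\<^esub>\<close>: moving the factors of \<open>e\<^sub>B\<close> into place costs
  a factor \<open>-1\<close> for each pair \<open>j < i\<close> (anticommutation) and for each pair \<open>j = i\<close>
  (\<open>e\<^sub>i\<^sup>2 = -1\<close>).
\<close>

definition reorder_sign :: "'n::{finite,linorder} set \<Rightarrow> 'n set \<Rightarrow> real" where
  "reorder_sign A B = (\<Prod>i\<in>A. \<Prod>j\<in>B. if j \<le> i then - 1 else 1)"

lemma prod_sign_sym_diff:
  fixes f :: "'n::finite \<Rightarrow> real"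
  assumes "\<And>i. f i * f i = 1"
  shows "prod f (sym_diff A B) = prod f A * prod f B"
proof -
  have A: "prod f A = prod f (A - B) * prod f (A \<inter> B)"
    by (metis Diff_disjoint Int_Diff_Un Int_Diff_disjoint finite inf_commute mult.commute
        prod.union_disjoint)
  have B: "prod f B = prod f (B - A) * prod f (A \<inter> B)"
    by (metis Int_Diff_Un Int_Diff_disjoint finite inf_commute mult.commute
        prod.union_disjoint)
  have I: "prod f (A \<inter> B) * prod f (A \<inter> B) = 1"
    by (simp add: prod.distrib [symmetric] assms)
  have "prod f (sym_diff A B) = prod f (A - B) * prod f (B - A)"
    by (rule prod.union_disjoint) auto
  also have "\<dots> = prod f (A - B) * prod f (B - A) * (prod f (A \<inter> B) * prod f (A \<inter> B))"
    by (simp add: I)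
  finally show ?thesis
    by (simp add: A B)
qed

lemma reorder_sign_square [simp]: "reorder_sign A B * reorder_sign A B = 1"
  unfolding reorder_sign_def prod.distrib [symmetric] by (auto intro!: prod.neutral)

lemma reorder_sign_square_left [simp]: "reorder_sign A B * (reorder_sign A B * x) = x"
  by (simp add: mult.assoc [symmetric])

lemma reorder_sign_sym_diff_left:
  "reorder_sign (sym_diff A B) C = reorder_sign A C * reorder_sign B C"
  unfolding reorder_sign_def
  by (rule prod_sign_sym_diff) (auto simp: prod.distrib [symmetric] intro!: prod.neutral)

lemma reorder_sign_sym_diff_right:
  "reorder_sign C (sym_diff A B) = reorder_sign C A * reorder_sign C B"
proof -
  have "(\<Prod>j\<in>sym_diff A B. if j \<le> i then - 1 else 1 :: real) =
      (\<Prod>j\<in>A. if j \<le> i then - 1 else 1) * (\<Prod>j\<in>B. if j \<le> i then - 1 else 1)" for i :: 'a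
    by (rule prod_sign_sym_diff) auto
  then show ?thesis
    unfolding reorder_sign_def by (simp add: prod.distrib)
qed

lemma reorder_sign_empty [simp]: "reorder_sign {} A = 1" "reorder_sign A {} = 1"
  by (simp_all add: reorder_sign_def)

instantiation clifford :: ("{finite,linorder}") real_algebra_1
begin

definition "0 = Clifford (\<lambda>_. 0)"
definition "1 = Clifford (\<lambda>A. if A = {} then 1 else 0)"
definition "a + b = Clifford (\<lambda>A. coeff a A + coeff b A)"
definition "a - b = Clifford (\<lambda>A. coeff a A - coeff b A)"
definition "- a = Clifford (\<lambda>A. - coeff a A)"
definition "r *\<^sub>R a = Clifford (\<lambda>A. r * coeff a A)"
definition "a * b = Clifford (\<lambda>C. \<Sum>A\<in>UNIV. \<Sum>B\<in>UNIV.
  if sym_diff A B = C then reorder_sign A B * coeff a A * coeff b B else 0)"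

lemma coeff_0 [simp]: "coeff 0 A = 0"
  and coeff_1: "coeff 1 A = (if A = {} then 1 else 0)"
  and coeff_add [simp]: "coeff (a + b) A = coeff a A + coeff b A"
  and coeff_diff [simp]: "coeff (a - b) A = coeff a A - coeff b A"
  and coeff_minus [simp]: "coeff (- a) A = - coeff a A"
  and coeff_scaleR [simp]: "coeff (r *\<^sub>R a) A = r * coeff a A"
  by (simp_all add: zero_clifford_def one_clifford_def plus_clifford_def minus_clifford_def
      uminus_clifford_def scaleR_clifford_def)

lemma sym_diff_eq_iff: "sym_diff A B = C \<longleftrightarrow> B = sym_diff A C"
  by blast

lemma coeff_mult: "coeff (a * b) C =
  (\<Sum>A\<in>UNIV. reorder_sign A (sym_diff A C) * coeff a A * coeff b (sym_diff A C))"
  by (simp add: times_clifford_def sym_diff_eq_iff)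

lemma clifford_mult_assoc: "a * b * c = a * (b * c)" for a b c :: "'a clifford"
proof -
  have "coeff (a * b * c) D = coeff (a * (b * c)) D" for D
  proof -
    have "coeff (a * b * c) D = (\<Sum>C\<in>UNIV. \<Sum>A\<in>UNIV. reorder_sign C (sym_diff C D) *
        (reorder_sign A (sym_diff A C) * coeff a A * coeff b (sym_diff A C)) *
        coeff c (sym_diff C D))"
      by (simp add: coeff_mult sum_distrib_left sum_distrib_right)
    also have "\<dots> = (\<Sum>A\<in>UNIV. \<Sum>C\<in>UNIV. reorder_sign C (sym_diff C D) *
        (reorder_sign A (sym_diff A C) * coeff a A * coeff b (sym_diff A C)) *
        coeff c (sym_diff C D))"
      by (rule sum.swap)
    also have "\<dots> = (\<Sum>A\<in>UNIV. \<Sum>B\<in>UNIV. reorder_sign A (sym_diff A D) * coeff a A *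
        (reorder_sign B (sym_diff B (sym_diff A D)) * coeff b B *
         coeff c (sym_diff B (sym_diff A D))))"
    proof (rule sum.cong [OF refl])
      fix A :: "'a set"
      have bij: "bij_betw (sym_diff A) UNIV UNIV"
        by (rule bij_betw_byWitness [where f' = "sym_diff A"]) blast+
      show "(\<Sum>C\<in>UNIV. reorder_sign C (sym_diff C D) *
          (reorder_sign A (sym_diff A C) * coeff a A * coeff b (sym_diff A C)) *
          coeff c (sym_diff C D)) =
        (\<Sum>B\<in>UNIV. reorder_sign A (sym_diff A D) * coeff a A *
          (reorder_sign B (sym_diff B (sym_diff A D)) * coeff b B *
           coeff c (sym_diff B (sym_diff A D))))"
      proof (subst sum.reindex_bij_betw [OF bij, symmetric], rule sum.cong [OF refl])
        fix B :: "'a set"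
        define E where "E = sym_diff B (sym_diff A D)"
        have 1: "sym_diff (sym_diff A B) D = E" "sym_diff A (sym_diff A B) = B"
            "sym_diff A D = sym_diff B E" "sym_diff B (sym_diff B E) = E"
          unfolding E_def by blast+
        show "reorder_sign (sym_diff A B) (sym_diff (sym_diff A B) D) *
          (reorder_sign A (sym_diff A (sym_diff A B)) * coeff a A *
            coeff b (sym_diff A (sym_diff A B))) * coeff c (sym_diff (sym_diff A B) D) =
          reorder_sign A (sym_diff A D) * coeff a A *
          (reorder_sign B (sym_diff B (sym_diff A D)) * coeff b B *
           coeff c (sym_diff B (sym_diff A D)))"
          unfolding E_def [symmetric] 1
          by (simp add: reorder_sign_sym_diff_left reorder_sign_sym_diff_right mult_ac)
      qed
    qed
    also have "\<dots> = coeff (a * (b * c)) D"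
      by (simp add: coeff_mult sum_distrib_left)
    finally show ?thesis .
  qed
  then show ?thesis
    by (simp add: clifford_eq_iff)
qed

instance
proof
  fix a b c :: "'a clifford" and r s :: real
  show "a * b * c = a * (b * c)"
    by (rule clifford_mult_assoc)
  show "1 * a = a"
  proof -
    have "(if A = {} then 1 else 0) * x = (if A = {} then x else 0)" for A :: "'a set" and x :: real
      by simp
    then show ?thesis
      by (simp add: clifford_eq_iff coeff_mult coeff_1 if_distrib if_distribR cong: if_cong)
  qed
  show "a * 1 = a"
  proof -
    have "sym_diff A C = {} \<longleftrightarrow> A = C" for A C :: "'a set"
      by blast
    then show ?thesis
      by (simp add: clifford_eq_iff coeff_mult coeff_1 if_distrib cong: if_cong)
  qed
  show "(0::'a clifford) \<noteq> 1"
    by (auto simp: clifford_eq_iff coeff_1)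
qed (simp_all add: clifford_eq_iff coeff_mult algebra_simps sum.distrib sum_distrib_left)

end

definition blade :: "'n set \<Rightarrow> 'n::{finite,linorder} clifford" where
  "blade A = Clifford (\<lambda>B. if B = A then 1 else 0)"

abbreviation gen :: "'n::{finite,linorder} \<Rightarrow> 'n clifford" where
  "gen i \<equiv> blade {i}"

lemma coeff_blade: "coeff (blade A) B = (if B = A then 1 else 0)"
  by (simp add: blade_def)

lemma blade_mult: "blade A * blade B = reorder_sign A B *\<^sub>R blade (sym_diff A B)"
proof -
  have "coeff (blade A * blade B) C = coeff (reorder_sign A B *\<^sub>R blade (sym_diff A B)) C" for C
  proof -
    have "coeff (blade A * blade B) C = (\<Sum>X\<in>UNIV. if X = A then
        reorder_sign A (sym_diff A C) * (if sym_diff A C = B then 1 else 0) else 0)"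
      unfolding coeff_mult coeff_blade by (rule sum.cong) auto
    moreover have "sym_diff A C = B \<longleftrightarrow> C = sym_diff A B"
      by (rule sym_diff_eq_iff)
    ultimately show ?thesis
      by (auto simp: coeff_blade)
  qed
  then show ?thesis
    by (simp add: clifford_eq_iff)
qed

lemma blade_empty: "blade {} = 1"
  by (simp add: clifford_eq_iff coeff_blade coeff_1)

lemma gen_square: "gen i * gen i = - 1"
  by (simp add: blade_mult reorder_sign_def blade_empty)

lemma gen_anticommute: "i \<noteq> j \<Longrightarrow> gen i * gen j = - (gen j * gen i)"
  by (auto simp: blade_mult reorder_sign_def insert_commute)

lemma blade_eq_prod_list: "blade A = prod_list (map gen (sorted_list_of_set A))"
  using finite [of A]
proof (induction A rule: finite_linorder_min_induct)
  case (insert i A)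
  have "sorted_list_of_set (insert i A) = i # sorted_list_of_set A"
    using insert by (subst sorted_list_of_set_nonempty) (auto simp: Min_insert2 less_imp_le)
  moreover have "blade (insert i A) = gen i * blade A"
  proof -
    have "reorder_sign {i} A = 1"
      unfolding reorder_sign_def using insert by (fastforce intro!: prod.neutral)
    moreover have "sym_diff {i} A = insert i A"
      using insert by auto
    ultimately show ?thesis
      by (simp only: blade_mult) simp
  qed
  ultimately show ?case
    by (simp add: insert)
qed (simp_all add: blade_empty)

lemma coeff_sum: "coeff (sum f S) A = (\<Sum>x\<in>S. coeff (f x) A)"
  by (induction S rule: infinite_finite_induct) simp_all

lemma clifford_expand: "a = (\<Sum>A\<in>UNIV. coeff a A *\<^sub>R blade A)"
  by (simp add: clifford_eq_iff coeff_sum coeff_blade if_distrib cong: if_cong)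

text \<open>
  The conjugation multiplies \<open>e\<^sub>A\<close> by \<open>(-1)\<^bsup>r(r+1)/2\<^esup>\<close>, \<open>r = card A\<close>, which is the sign in
  \<open>e\<^sub>A e\<^sub>A = \<plusminus>1\<close>.  The lemmas below show that it is the real-linear antihomomorphism
  with \<open>e\<^sub>i \<mapsto> -e\<^sub>i\<close>.
\<close>

definition clifford_conj :: "'n::{finite,linorder} clifford \<Rightarrow> 'n clifford" where
  "clifford_conj a = Clifford (\<lambda>A. reorder_sign A A * coeff a A)"

lemma coeff_clifford_conj: "coeff (clifford_conj a) A = reorder_sign A A * coeff a A"
  by (simp add: clifford_conj_def)

lemma clifford_conj_add: "clifford_conj (a + b) = clifford_conj a + clifford_conj b"
  and clifford_conj_scaleR: "clifford_conj (r *\<^sub>R a) = r *\<^sub>R clifford_conj a"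
  and clifford_conj_1: "clifford_conj 1 = 1"
  and clifford_conj_gen: "clifford_conj (gen i) = - gen i"
  by (auto simp: clifford_eq_iff coeff_clifford_conj coeff_1 coeff_blade algebra_simps reorder_sign_def)

lemma clifford_conj_mult: "clifford_conj (a * b) = clifford_conj b * clifford_conj a"
proof -
  have "coeff (clifford_conj (a * b)) C = coeff (clifford_conj b * clifford_conj a) C" for C
  proof -
    have bij: "bij_betw (sym_diff C) UNIV UNIV"
      by (rule bij_betw_byWitness [where f' = "sym_diff C"]) blast+
    show ?thesis
      unfolding coeff_clifford_conj coeff_mult sum_distrib_left
    proof (subst sum.reindex_bij_betw [OF bij, symmetric], rule sum.cong [OF refl])
      fix B :: "'a set"
      define A where "A = sym_diff C B"
      have 1: "C = sym_diff A B" "sym_diff A (sym_diff A B) = B" "sym_diff B (sym_diff A B) = A"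
          "sym_diff (sym_diff A B) B = A"
        unfolding A_def by blast+
      show "reorder_sign C C * (reorder_sign (sym_diff C B) (sym_diff (sym_diff C B) C) *
          coeff a (sym_diff C B) * coeff b (sym_diff (sym_diff C B) C)) =
        reorder_sign B (sym_diff B C) * (reorder_sign B B * coeff b B) *
        (reorder_sign (sym_diff B C) (sym_diff B C) * coeff a (sym_diff B C))"
        unfolding 1
        by (simp add: reorder_sign_sym_diff_left reorder_sign_sym_diff_right mult_ac)
    qed
  qed
  then show ?thesis
    by (simp add: clifford_eq_iff)
qed

definition clifford_nonneg :: "'n::{finite,linorder} clifford \<Rightarrow> bool" where
  "clifford_nonneg a \<longleftrightarrow> (\<exists>b. a = b * clifford_conj b)"

text \<open>
  \<open>x = \<Sum>\<^sub>A x\<^sub>A e\<^sub>A\<close> is the vector with components \<open>x $ A = x\<^sub>A\<close>.  The library norm on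
  this vector type is \<open>(\<Sum>\<^sub>A \<parallel>x\<^sub>A\<parallel>\<^sup>2)\<^bsup>1/2\<^esup>\<close>.
\<close>

type_synonym ('h, 'n) clifford_module = "('h, 'n set) vec"

definition right_mult ::
  "('h::real_inner, 'n::{finite,linorder}) clifford_module \<Rightarrow> 'n clifford \<Rightarrow> ('h, 'n) clifford_module"
  where "right_mult x a = (\<chi> C. \<Sum>A\<in>UNIV. coeff (blade A * a) C *\<^sub>R (x $ A))"

definition cinner ::
  "('h::real_inner, 'n::{finite,linorder}) clifford_module \<Rightarrow> ('h, 'n) clifford_module \<Rightarrow> 'n clifford"
  where "cinner x y = (\<Sum>A\<in>UNIV. \<Sum>B\<in>UNIV. (x $ A \<bullet> y $ B) *\<^sub>R (clifford_conj (blade B) * blade A))"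

lemma cinner_right_mult: "cinner (right_mult x a) y = cinner x y * a"
proof -
  have "cinner (right_mult x a) y =
    (\<Sum>C\<in>UNIV. \<Sum>B\<in>UNIV. \<Sum>A\<in>UNIV. (x $ A \<bullet> y $ B) *\<^sub>R
      (clifford_conj (blade B) * (coeff (blade A * a) C *\<^sub>R blade C)))"
    by (simp add: cinner_def right_mult_def inner_sum_left scaleR_sum_left mult_ac)
  also have "\<dots> = (\<Sum>B\<in>UNIV. \<Sum>C\<in>UNIV. \<Sum>A\<in>UNIV. (x $ A \<bullet> y $ B) *\<^sub>R
      (clifford_conj (blade B) * (coeff (blade A * a) C *\<^sub>R blade C)))"
    by (rule sum.swap)
  also have "\<dots> = (\<Sum>B\<in>UNIV. \<Sum>A\<in>UNIV. \<Sum>C\<in>UNIV. (x $ A \<bullet> y $ B) *\<^sub>R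
      (clifford_conj (blade B) * (coeff (blade A * a) C *\<^sub>R blade C)))"
    by (intro sum.cong refl sum.swap)
  also have "\<dots> = (\<Sum>A\<in>UNIV. \<Sum>B\<in>UNIV. \<Sum>C\<in>UNIV. (x $ A \<bullet> y $ B) *\<^sub>R
      (clifford_conj (blade B) * (coeff (blade A * a) C *\<^sub>R blade C)))"
    by (rule sum.swap)
  also have "\<dots> = (\<Sum>A\<in>UNIV. \<Sum>B\<in>UNIV. (x $ A \<bullet> y $ B) *\<^sub>R
      (clifford_conj (blade B) * (\<Sum>C\<in>UNIV. coeff (blade A * a) C *\<^sub>R blade C)))"
    by (simp add: sum_distrib_left scaleR_sum_right)
  also have "\<dots> = cinner x y * a"
    by (simp add: clifford_expand [symmetric] cinner_def sum_distrib_right mult.assoc)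
  finally show ?thesis .
qed

lemma norm_eq_cinner:
  fixes x :: "('h::real_inner, 'n::{finite,linorder}) clifford_module"
  shows "(norm x)\<^sup>2 = coeff (cinner x x) {}"
proof -
  have *: "coeff (clifford_conj (blade B) * blade A) {} = (if A = B then 1 else 0)" for A B :: "'n set"
  proof -
    have "coeff (clifford_conj (blade B) * blade A) {} = (\<Sum>X\<in>UNIV. if X = B then if A = B then 1 else 0 else 0)"
      unfolding coeff_mult coeff_clifford_conj coeff_blade by (rule sum.cong) auto
    then show ?thesis
      by simp
  qed
  show ?thesis
    by (simp add: * cinner_def coeff_sum inner_vec_def power2_norm_eq_inner if_distrib
        cong: if_cong)
qed

type_synonym ('h, 'n) clifford_op = "('h, 'n) clifford_module \<Rightarrow> ('h, 'n) clifford_module"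

definition bounded_op :: "('h::real_inner, 'n::{finite,linorder}) clifford_op \<Rightarrow> bool" where
  "bounded_op T \<longleftrightarrow> bounded_linear T \<and> (\<forall>x a. T (right_mult x a) = right_mult (T x) a)"

definition adj :: "('h::real_inner, 'n::{finite,linorder}) clifford_op \<Rightarrow> ('h, 'n) clifford_op" where
  "adj T = (THE S. bounded_op S \<and> (\<forall>x y. cinner (T x) y = cinner x (S y)))"

definition normal_op :: "('h::real_inner, 'n::{finite,linorder}) clifford_op \<Rightarrow> bool" where
  "normal_op T \<longleftrightarrow> bounded_op T \<and> T \<circ> adj T = adj T \<circ> T"

definition unitary_op :: "('h::real_inner, 'n::{finite,linorder}) clifford_op \<Rightarrow> bool" where
  "unitary_op T \<longleftrightarrow> bounded_op T \<and> T \<circ> adj T = id \<and> adj T \<circ> T = id"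

definition positive_op :: "('h::real_inner, 'n::{finite,linorder}) clifford_op \<Rightarrow> bool" where
  "positive_op T \<longleftrightarrow> bounded_op T \<and> (\<forall>x. clifford_nonneg (cinner (T x) x))"

definition sqrt_op :: "('h::real_inner, 'n::{finite,linorder}) clifford_op \<Rightarrow> ('h, 'n) clifford_op" where
  "sqrt_op P = (THE S. positive_op S \<and> S \<circ> S = P)"

definition abs_op :: "('h::real_inner, 'n::{finite,linorder}) clifford_op \<Rightarrow> ('h, 'n) clifford_op" where
  "abs_op T = sqrt_op (adj T \<circ> T)"

definition op_kernel :: "('h::real_inner, 'n::{finite,linorder}) clifford_op \<Rightarrow> ('h, 'n) clifford_module set" where
  "op_kernel T = {x. T x = 0}"

definition orth_compl ::
  "('h::real_inner, 'n::{finite,linorder}) clifford_module set \<Rightarrow> ('h, 'n) clifford_module set" where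
  "orth_compl S = {x. \<forall>y\<in>S. cinner x y = 0}"

definition partial_isometry :: "('h::real_inner, 'n::{finite,linorder}) clifford_op \<Rightarrow> bool" where
  "partial_isometry U \<longleftrightarrow> bounded_op U \<and> (\<forall>x\<in>orth_compl (op_kernel U). norm (U x) = norm x)"

text \<open>
  \<open>T = U Q\<close> with \<open>Q\<close> positive and \<open>U\<close> a partial isometry from the closure of
  \<open>Ran Q\<close> onto the closure of \<open>Ran T\<close>, extended by \<open>0\<close>.
\<close>

definition polar_decomposition ::
  "('h::real_inner, 'n::{finite,linorder}) clifford_op \<Rightarrow> ('h, 'n) clifford_op \<Rightarrow> ('h, 'n) clifford_op \<Rightarrow> bool"
  where "polar_decomposition T U Q \<longleftrightarrow>
    T = U \<circ> Q \<and> positive_op Q \<and> partial_isometry U \<and>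
    op_kernel U = orth_compl (closure (range Q)) \<and>
    U ` closure (range Q) = closure (range T)"

end

theory Submission
  imports Defs
begin

text \<open>
  Bounded right \<open>\<real>\<^sub>n\<close>-linear operators are the bounded operators of the real Hilbert space
  \<open>H\<^sub>n\<close>, with inner product \<open>Re \<langle>x, y\<rangle>\<close>, that commute with all right multiplications.  The adjoint is the
  real adjoint, and positivity amounts to being real self-adjoint and positive semidefinite.  The
  square root of a positive semidefinite \<open>A\<close> and the partial isometry of the polar decomposition are
  strong limits of expressions in the given operators, so they commute with everything those operators
  commute with.  Applied to right multiplications this gives Clifford linearity; applied to \<open>W\<close>
  it gives the commutation statements; applied to \<open>T\<close>, \<open>T\<^sup>*\<close> and \<open>U\<^sup>*\<close> it gives unitarity of \<open>U\<close> in the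
  normal case.
\<close>

section \<open>Adjoints and square roots in real Hilbert spaces\<close>

text \<open>Limits of explicit iterations replace functional calculus, so that commutation survives
  by continuity. It is proved for every bounded real-linear \<open>W\<close>, because a right
  multiplication need not itself be right Clifford-linear. Passing between real and Clifford
  positivity takes work both ways. Symmetry follows from the Clifford condition only because a
  generator exists; over the reals alone it would fail. Conversely, a nonnegative real form yields a
  factorisation \<open>b * clifford_conj b\<close> only once a square root has been extracted inside
  the algebra. The equivalence with normality concerns a unitary factor. For the partial isometry
  only one direction can hold: the unilateral shift has |T| = I, which commutes with U = T, yet it
  is not normal.\<close>

lemma riesz_representation:
  fixes f :: "'a::{real_inner,complete_space} \<Rightarrow> real"
  assumes "bounded_linear f"
  shows "\<exists>y. \<forall>x. f x = x \<bullet> y"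
proof -
  interpret f: bounded_linear f by fact
  obtain K where K: "norm (f x) \<le> norm x * K" for x
    using f.bounded by blast
  \<comment> \<open>If y represents \<open>f\<close>, then \<open>g x\<close> is the squared
    distance from x to y up to a constant, so y is sought as a minimiser of
    \<open>g\<close>.\<close>
  define g where "g x = x \<bullet> x - 2 * f x" for x
  have lower: "- K\<^sup>2 \<le> g x" for x
  proof -
    have "f x \<le> norm x * K"
      using K [of x] by simp
    moreover have "0 \<le> (norm x - K)\<^sup>2"
      by simp
    ultimately show ?thesis
      unfolding g_def power2_norm_eq_inner [symmetric] by (simp add: power2_diff)
  qed
  define m where "m = Inf (range g)"
  have bdd: "bdd_below (range g)"
    by (rule bdd_belowI [of _ "- K\<^sup>2"]) (use lower in auto)
  have m: "m \<le> g x" for x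
    unfolding m_def using bdd by (auto intro: cInf_lower)
  have "\<exists>x. g x < m + inverse (real (Suc n))" for n
    using cInf_less_iff [OF _ bdd, of "m + inverse (real (Suc n))"] by (auto simp: m_def)
  then obtain X where X: "g (X n) < m + inverse (real (Suc n))" for n
    by metis
  \<comment> \<open>Parallelogram law: the value at the midpoint is at least \<open>m\<close>, so
    two nearly minimal points are close.\<close>
  have par: "g x + g y = 2 * g ((1/2) *\<^sub>R (x + y)) + (norm (x - y))\<^sup>2 / 2" for x y
    unfolding g_def power2_norm_eq_inner
    by (simp add: f.add f.scaleR inner_add_left inner_add_right inner_diff_left inner_diff_right
        inner_commute field_simps)
  have dist: "(norm (X n - X k))\<^sup>2 < 2 * (inverse (real (Suc n)) + inverse (real (Suc k)))" for n k
    using par [of "X n" "X k"] m [of "(1/2) *\<^sub>R (X n + X k)"] X [of n] X [of k] by argo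
  have "Cauchy X"
  proof (rule metric_CauchyI)
    fix e :: real assume "0 < e"
    then obtain N where N: "inverse (real (Suc N)) < e\<^sup>2 / 4"
      using reals_Archimedean [of "e\<^sup>2 / 4"] by auto
    have "dist (X n) (X k) < e" if "n \<ge> N" "k \<ge> N" for n k
    proof -
      have "inverse (real (Suc n)) \<le> inverse (real (Suc N))"
        "inverse (real (Suc k)) \<le> inverse (real (Suc N))"
        using that by (auto intro: le_imp_inverse_le)
      then have "(norm (X n - X k))\<^sup>2 < e\<^sup>2"
        using dist [of n k] N by argo
      then show ?thesis
        using \<open>0 < e\<close> by (simp add: dist_norm power_less_imp_less_base)
    qed
    then show "\<exists>M. \<forall>m\<ge>M. \<forall>n\<ge>M. dist (X m) (X n) < e"
      by blast
  qed
  then obtain y where y: "X \<longlonglongrightarrow> y"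
    using Cauchy_convergent_iff convergent_def by blast
  have "(\<lambda>n. g (X n)) \<longlonglongrightarrow> g y"
    unfolding g_def by (intro tendsto_intros y f.tendsto)
  moreover have "(\<lambda>n. m + inverse (real (Suc n))) \<longlonglongrightarrow> m + 0"
    by (intro tendsto_intros LIMSEQ_inverse_real_of_nat)
  ultimately have "g y \<le> m"
    using LIMSEQ_le [of _ "g y" _ "m + 0"] X by (auto simp: less_imp_le)
  then have min: "g y \<le> g x" for x
    using m order_trans by blast
  have "f x = x \<bullet> y" for x
  proof -
    define d where "d = x \<bullet> y - f x"
    define s where "s = x \<bullet> x"
    have quad: "0 \<le> t * t * s + 2 * t * d" for t
      using min [of "y + t *\<^sub>R x"]
      by (simp add: g_def d_def s_def f.add f.scaleR inner_add_left inner_add_right inner_commute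
          algebra_simps)
    have s: "0 \<le> s"
      by (simp add: s_def)
    \<comment> \<open>The divisor \<open>s + 1\<close> is positive even for x = 0; testing
      \<open>quad\<close> at \<open>- u\<close> leaves
      \<open>u * u * (s + 2) \<le> 0\<close>.\<close>
    define u where "u = d / (s + 1)"
    have d: "d = u * (s + 1)"
      using s by (simp add: u_def add_nonneg_eq_0_iff)
    have "u * u * (s + 2) \<le> 0"
      using quad [of "- u"] by (simp add: d algebra_simps)
    then have "u = 0"
      using s by (auto simp: mult_le_0_iff)
    then have "d = 0"
      by (simp add: d)
    then show ?thesis
      by (simp add: d_def)
  qed
  then show ?thesis
    by blast
qed

lemma
  fixes T :: "'a::{real_inner,complete_space} \<Rightarrow> 'b::real_inner"
  assumes "bounded_linear T"
  shows inner_adjoint: "T x \<bullet> y = x \<bullet> adjoint T y"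
    and bounded_linear_adjoint: "bounded_linear (adjoint T)"
proof -
  interpret T: bounded_linear T by fact
  have "\<exists>z. \<forall>x. T x \<bullet> y = x \<bullet> z" for y
    by (rule riesz_representation) (rule bounded_linear_inner_left_comp [OF assms])
  then obtain S where "\<forall>x y. T x \<bullet> y = x \<bullet> S y"
    by metis
  moreover from this have "adjoint T = S"
    by (rule adjoint_unique)
  ultimately have *: "T x \<bullet> y = x \<bullet> adjoint T y" for x y
    by simp
  show "T x \<bullet> y = x \<bullet> adjoint T y"
    by (rule *)
  obtain K where K: "norm (T x) \<le> norm x * K" and "0 \<le> K" for x
    using T.nonneg_bounded by blast
  show "bounded_linear (adjoint T)"
  proof (rule bounded_linear_intro)
    show "adjoint T (x + y) = adjoint T x + adjoint T y" for x y
      by (rule vector_eq_ldot [THEN iffD1]) (simp add: * [symmetric] inner_add_right)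
    show "adjoint T (r *\<^sub>R x) = r *\<^sub>R adjoint T x" for r x
      by (rule vector_eq_ldot [THEN iffD1]) (simp add: * [symmetric])
    show "norm (adjoint T x) \<le> norm x * K" for x
    proof -
      have "norm (adjoint T x) * norm (adjoint T x) = T (adjoint T x) \<bullet> x"
        by (simp add: * norm_eq_sqrt_inner)
      also have "\<dots> \<le> norm (T (adjoint T x)) * norm x"
        by (rule norm_cauchy_schwarz)
      also have "\<dots> \<le> norm (adjoint T x) * K * norm x"
        by (intro mult_right_mono K) auto
      finally have "norm (adjoint T x) * norm (adjoint T x) \<le> norm (adjoint T x) * (norm x * K)"
        by (simp add: mult_ac)
      then show ?thesis
        using \<open>0 \<le> K\<close> by (cases "adjoint T x = 0") auto
    qed
  qed
qed

lemma bounded_linear_LIMSEQ: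
  fixes F :: "nat \<Rightarrow> 'a::real_normed_vector \<Rightarrow> 'b::real_normed_vector"
  assumes lin: "\<And>k. bounded_linear (F k)" and bound: "\<And>k x. norm (F k x) \<le> norm x * C"
    and lim: "\<And>x. (\<lambda>k. F k x) \<longlonglongrightarrow> G x"
  shows "bounded_linear G" and "norm (G x) \<le> norm x * C"
proof -
  interpret F: bounded_linear "F k" for k
    by (rule lin)
  show le: "norm (G x) \<le> norm x * C" for x
    by (rule LIMSEQ_le_const2 [OF tendsto_norm [OF lim]]) (use bound in blast)
  show "bounded_linear G"
  proof (rule bounded_linear_intro [OF _ _ le])
    show "G (x + y) = G x + G y" for x y
      by (rule LIMSEQ_unique [OF lim]) (simp add: F.add tendsto_add lim)
    show "G (r *\<^sub>R x) = r *\<^sub>R G x" for r x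
      by (rule LIMSEQ_unique [OF lim]) (simp add: F.scaleR tendsto_scaleR lim)
  qed
qed

text \<open>Over the reals a nonnegative quadratic form does not force symmetry, so symmetry is
  demanded separately.\<close>

definition psd :: "('a::real_inner \<Rightarrow> 'a) \<Rightarrow> bool" where
  "psd A \<longleftrightarrow> bounded_linear A \<and> (\<forall>x y. A x \<bullet> y = x \<bullet> A y) \<and> (\<forall>x. 0 \<le> A x \<bullet> x)"

lemma psdD:
  assumes "psd A"
  shows "bounded_linear A" "A x \<bullet> y = x \<bullet> A y" "0 \<le> A x \<bullet> x"
  using assms by (auto simp: psd_def)

text \<open>Positivity of \<open>A\<close> at \<open>x - A x\<close>, combined with A \<le> I at
  \<open>A x\<close>, is the operator inequality A^2 \<le> A.\<close>

lemma psd_contraction: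
  assumes "psd A" and le: "\<And>x. A x \<bullet> x \<le> x \<bullet> x"
  shows "A x \<bullet> A x \<le> A x \<bullet> x"
proof -
  interpret A: bounded_linear A
    using assms by (simp add: psd_def)
  have "0 \<le> A (x - A x) \<bullet> (x - A x)"
    using assms(1) by (rule psdD)
  also have "\<dots> = A x \<bullet> x - 2 * (A x \<bullet> A x) + A (A x) \<bullet> A x"
    using psdD(2) [OF assms(1)] by (simp add: A.diff inner_diff_left inner_diff_right inner_commute)
  finally show ?thesis
    using le [of "A x"] by simp
qed

text \<open>Normalises \<open>A\<close> to lie between 0 and I, where both the square root iteration
  and the power iteration converge.\<close>

lemma psd_scale_le:
  assumes "psd A"
  obtains c where "0 < c" "\<And>x. c * (A x \<bullet> x) \<le> x \<bullet> x"
proof -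
  interpret A: bounded_linear A
    using assms by (simp add: psd_def)
  obtain K where K: "norm (A x) \<le> norm x * K" and "0 < K" for x
    using A.pos_bounded by blast
  have "inverse K * (A x \<bullet> x) \<le> x \<bullet> x" for x
  proof -
    have "A x \<bullet> x \<le> norm (A x) * norm x"
      by (rule norm_cauchy_schwarz)
    also have "\<dots> \<le> norm x * K * norm x"
      by (intro mult_right_mono K) auto
    also have "\<dots> = K * (x \<bullet> x)"
      by (simp add: power2_norm_eq_inner [symmetric] power2_eq_square)
    finally show ?thesis
      using \<open>0 < K\<close> by (simp add: field_simps)
  qed
  then show thesis
    using that [of "inverse K"] \<open>0 < K\<close> by simp
qed

text \<open>
  If \<open>S = I - Y\<close> and \<open>B = I - A\<close>, then \<open>S\<^sup>2 = A\<close> says that \<open>Y\<close> is a fixed point of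
  \<open>Y \<mapsto> (B + Y\<^sup>2) / 2\<close>.  For \<open>\<parallel>B\<parallel> \<le> 1\<close> the increments of the iteration are dominated in norm
  by those of the scalar iteration with \<open>B = 1\<close>, which is increasing and bounded by \<open>1\<close>.
\<close>

primrec sqrt_iter :: "('a::real_vector \<Rightarrow> 'a) \<Rightarrow> nat \<Rightarrow> 'a \<Rightarrow> 'a" where
  "sqrt_iter B 0 = (\<lambda>x. 0)"
| "sqrt_iter B (Suc k) = (\<lambda>x. (1/2) *\<^sub>R (B x + sqrt_iter B k (sqrt_iter B k x)))"

primrec scalar_iter :: "nat \<Rightarrow> real" where
  "scalar_iter 0 = 0"
| "scalar_iter (Suc k) = (1 + (scalar_iter k)\<^sup>2) / 2"

lemma scalar_iter_bounds: "0 \<le> scalar_iter k" "scalar_iter k \<le> 1"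
proof -
  have "0 \<le> scalar_iter k \<and> scalar_iter k \<le> 1"
    by (induction k) (auto simp: power_le_one)
  then show "0 \<le> scalar_iter k" "scalar_iter k \<le> 1"
    by auto
qed

lemma incseq_scalar_iter: "incseq scalar_iter"
proof (rule incseq_SucI)
  fix k
  have "0 \<le> (1 - scalar_iter k)\<^sup>2"
    by simp
  then show "scalar_iter k \<le> scalar_iter (Suc k)"
    by (simp add: power2_diff)
qed

context
  fixes B :: "'a::real_inner \<Rightarrow> 'a"
  assumes B: "bounded_linear B" and B_le: "\<And>x. norm (B x) \<le> norm x"
begin

lemma bounded_linear_sqrt_iter: "bounded_linear (sqrt_iter B k)"
  by (induction k) (auto intro!: bounded_linear_zero bounded_linear_const_scaleR bounded_linear_add B
      intro: bounded_linear_compose)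

lemma norm_sqrt_iter: "norm (sqrt_iter B k x) \<le> scalar_iter k * norm x"
proof (induction k arbitrary: x)
  case (Suc k)
  have "norm (sqrt_iter B k (sqrt_iter B k x)) \<le> scalar_iter k * (scalar_iter k * norm x)"
    by (rule order_trans [OF Suc]) (intro mult_left_mono Suc scalar_iter_bounds)
  then have "norm (B x + sqrt_iter B k (sqrt_iter B k x)) \<le> (1 + (scalar_iter k)\<^sup>2) * norm x"
    using norm_triangle_ineq [of "B x" "sqrt_iter B k (sqrt_iter B k x)"] B_le [of x]
    by (simp add: power2_eq_square algebra_simps)
  then show ?case
    by simp
qed simp

text \<open>Z^2 - Y^2 = Z(Z - Y) + (Z - Y)Y needs no commutation, and the resulting bound t(t - s) +
  (t - s)s = t^2 - s^2 is twice the next scalar increment.\<close>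

lemma norm_sqrt_iter_Suc_diff:
  "norm (sqrt_iter B (Suc k) x - sqrt_iter B k x) \<le> (scalar_iter (Suc k) - scalar_iter k) * norm x"
proof (induction k arbitrary: x)
  case 0
  show ?case
    using B_le [of x] by simp
next
  case (Suc k)
  define Y where "Y = sqrt_iter B k"
  define Z where "Z = sqrt_iter B (Suc k)"
  define s where "s = scalar_iter k"
  define t where "t = scalar_iter (Suc k)"
  have "bounded_linear Y" "bounded_linear Z"
    unfolding Y_def Z_def by (fact bounded_linear_sqrt_iter)+
  then interpret Y: bounded_linear Y + Z: bounded_linear Z .
  have IH: "norm (Z v - Y v) \<le> (t - s) * norm v" for v
    using Suc by (simp only: Z_def Y_def s_def t_def)
  have "0 \<le> t - s"
    using incseq_SucD [OF incseq_scalar_iter, of k] by (simp add: s_def t_def)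
  have 1: "norm (Z (Z x - Y x)) \<le> t * ((t - s) * norm x)"
    by (rule order_trans [OF norm_sqrt_iter [of "Suc k", folded Z_def t_def]])
      (intro mult_left_mono IH scalar_iter_bounds [of "Suc k", folded t_def])
  have 2: "norm (Z (Y x) - Y (Y x)) \<le> (t - s) * (s * norm x)"
    by (rule order_trans [OF IH], rule mult_left_mono [OF _ \<open>0 \<le> t - s\<close>])
      (rule norm_sqrt_iter [of k, folded Y_def s_def])
  have "sqrt_iter B (Suc (Suc k)) x - sqrt_iter B (Suc k) x = (1/2) *\<^sub>R (Z (Z x) - Y (Y x))"
    unfolding sqrt_iter.simps(2) [of B "Suc k"] Z_def [symmetric]
    by (simp add: Z_def Y_def algebra_simps)
  also have "\<dots> = (1/2) *\<^sub>R (Z (Z x - Y x) + (Z (Y x) - Y (Y x)))"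
    by (simp add: Z.diff)
  finally have "norm (sqrt_iter B (Suc (Suc k)) x - sqrt_iter B (Suc k) x) \<le>
      (1/2) * (t * ((t - s) * norm x) + (t - s) * (s * norm x))"
    using norm_triangle_ineq [of "Z (Z x - Y x)" "Z (Y x) - Y (Y x)"] 1 2 by simp
  also have "\<dots> = (scalar_iter (Suc (Suc k)) - scalar_iter (Suc k)) * norm x"
    unfolding scalar_iter.simps(2) [of "Suc k"]
    by (simp add: s_def t_def power2_eq_square algebra_simps add_divide_distrib diff_divide_distrib)
  finally show ?case .
qed

lemma norm_sqrt_iter_diff:
  assumes "k \<le> m"
  shows "norm (sqrt_iter B m x - sqrt_iter B k x) \<le> (scalar_iter m - scalar_iter k) * norm x"
  using assms
proof (induction rule: dec_induct)
  case (step m)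
  have "sqrt_iter B (Suc m) x - sqrt_iter B k x =
      (sqrt_iter B (Suc m) x - sqrt_iter B m x) + (sqrt_iter B m x - sqrt_iter B k x)"
    by (simp del: sqrt_iter.simps)
  then show ?case
    using norm_triangle_ineq [of "sqrt_iter B (Suc m) x - sqrt_iter B m x" "sqrt_iter B m x - sqrt_iter B k x"]
      norm_sqrt_iter_Suc_diff [of m x] step by (simp del: sqrt_iter.simps scalar_iter.simps add: algebra_simps)
qed simp

lemma Cauchy_sqrt_iter: "Cauchy (\<lambda>k. sqrt_iter B k x)"
proof (rule metric_CauchyI)
  fix e :: real assume "0 < e"
  have "convergent scalar_iter"
    using incseq_convergent [OF incseq_scalar_iter] scalar_iter_bounds convergent_def by metis
  then have "Cauchy scalar_iter"
    by (simp add: Cauchy_convergent_iff)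
  then obtain N where N: "\<And>m k. m \<ge> N \<Longrightarrow> k \<ge> N \<Longrightarrow> dist (scalar_iter m) (scalar_iter k) < e / (norm x + 1)"
    using metric_CauchyD [of scalar_iter "e / (norm x + 1)"] \<open>0 < e\<close>
    by (auto simp: add_nonneg_pos)
  have *: "dist (sqrt_iter B m x) (sqrt_iter B k x) < e" if "N \<le> k" "k \<le> m" for k m
  proof -
    have "dist (sqrt_iter B m x) (sqrt_iter B k x) \<le> (scalar_iter m - scalar_iter k) * norm x"
      using norm_sqrt_iter_diff [OF that(2)] by (simp add: dist_norm)
    also have "\<dots> \<le> (scalar_iter m - scalar_iter k) * (norm x + 1)"
      using incseqD [OF incseq_scalar_iter that(2)] by (intro mult_left_mono) auto
    also have "\<dots> < e / (norm x + 1) * (norm x + 1)"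
      using N [of m k] that by (intro mult_strict_right_mono) (auto simp: dist_real_def add_nonneg_pos)
    also have "\<dots> = e"
      by (simp add: add_nonneg_eq_0_iff)
    finally show ?thesis .
  qed
  then show "\<exists>M. \<forall>m\<ge>M. \<forall>n\<ge>M. dist (sqrt_iter B m x) (sqrt_iter B n x) < e"
    by (metis dist_commute nle_le)
qed

lemma sqrt_iter_commute:
  assumes "linear W" and "\<And>x. W (B x) = B (W x)"
  shows "W (sqrt_iter B k x) = sqrt_iter B k (W x)"
proof (induction k arbitrary: x)
  case (Suc k)
  then show ?case
    using assms by (simp add: linear_add linear_scale)
qed (use assms linear_0 in auto)

lemma sqrt_iter_self_adjoint:
  assumes "\<And>x y. B x \<bullet> y = x \<bullet> B y"
  shows "sqrt_iter B k x \<bullet> y = x \<bullet> sqrt_iter B k y"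
  by (induction k arbitrary: x y) (auto simp: inner_add_left inner_add_right assms)

end

theorem psd_sqrt_exists:
  fixes A :: "'a::{real_inner,complete_space} \<Rightarrow> 'a"
  assumes A: "psd A"
  obtains S where "psd S" and "\<And>x. S (S x) = A x"
    and "\<And>W x. bounded_linear W \<Longrightarrow> (\<And>y. W (A y) = A (W y)) \<Longrightarrow> W (S x) = S (W x)"
proof -
  interpret A: bounded_linear A
    using A by (simp add: psd_def)
  obtain c where "0 < c" and c: "\<And>x. c * (A x \<bullet> x) \<le> x \<bullet> x"
    using psd_scale_le [OF A] by blast
  define B where "B x = x - c *\<^sub>R A x" for x
  have blB: "bounded_linear B"
    unfolding B_def by (intro bounded_linear_sub bounded_linear_ident bounded_linear_const_scaleR A.bounded_linear)
  have "psd (\<lambda>x. c *\<^sub>R A x)"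
    using A \<open>0 < c\<close> by (auto simp: psd_def intro: bounded_linear_const_scaleR)
  \<comment> \<open>Since (cA)^2 \<le> cA, expanding B^2 gives at most I - cA, hence
    \<open>B\<close> is a contraction.\<close>
  from psd_contraction [OF this] have contr: "(c *\<^sub>R A x) \<bullet> (c *\<^sub>R A x) \<le> (c *\<^sub>R A x) \<bullet> x" for x
    using c by simp
  have normB: "norm (B x) \<le> norm x" for x
  proof -
    have "B x \<bullet> B x = x \<bullet> x - 2 * (c *\<^sub>R A x \<bullet> x) + (c *\<^sub>R A x) \<bullet> (c *\<^sub>R A x)"
      unfolding B_def by (simp add: inner_diff_left inner_diff_right inner_commute)
    also have "\<dots> \<le> x \<bullet> x"
      using contr [of x] psdD(3) [OF A, of x] \<open>0 < c\<close> by (simp add: mult_nonneg_nonneg)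
    finally show ?thesis
      by (simp add: norm_le)
  qed
  have saB: "B x \<bullet> y = x \<bullet> B y" for x y
    unfolding B_def by (simp add: inner_diff_left inner_diff_right psdD(2) [OF A])
  define Y where "Y x = lim (\<lambda>k. sqrt_iter B k x)" for x
  have Y: "(\<lambda>k. sqrt_iter B k x) \<longlonglongrightarrow> Y x" for x
    unfolding Y_def using Cauchy_sqrt_iter [OF blB normB]
    by (simp add: Cauchy_convergent_iff convergent_LIMSEQ_iff)
  note bli = bounded_linear_sqrt_iter [OF blB normB]
  have le1: "norm (sqrt_iter B k x) \<le> norm x * 1" for k x
    using norm_sqrt_iter [OF blB normB, of k x] mult_right_mono [OF scalar_iter_bounds(2), of "norm x" k]
    by simp
  note blY = bounded_linear_LIMSEQ(1) [OF bli le1 Y]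
  have normY: "norm (Y x) \<le> norm x" for x
    using bounded_linear_LIMSEQ(2) [OF bli le1 Y] by simp
  interpret Y: bounded_linear Y
    by (fact blY)
  have saY: "Y x \<bullet> y = x \<bullet> Y y" for x y
  proof (rule LIMSEQ_unique)
    show "(\<lambda>k. sqrt_iter B k x \<bullet> y) \<longlonglongrightarrow> Y x \<bullet> y"
      by (intro tendsto_intros Y)
    show "(\<lambda>k. sqrt_iter B k x \<bullet> y) \<longlonglongrightarrow> x \<bullet> Y y"
      unfolding sqrt_iter_self_adjoint [OF blB normB saB] by (intro tendsto_intros Y)
  qed
  \<comment> \<open>Operator and argument both vary with k; the uniform bound 1 on the iterates
    controls the error in the argument.\<close>
  have "(\<lambda>k. sqrt_iter B k (sqrt_iter B k x)) \<longlonglongrightarrow> Y (Y x)" for x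
  proof -
    have "(\<lambda>k. sqrt_iter B k (sqrt_iter B k x - Y x)) \<longlonglongrightarrow> 0"
    proof (rule Lim_null_comparison)
      show "\<forall>\<^sub>F k in sequentially. norm (sqrt_iter B k (sqrt_iter B k x - Y x)) \<le> norm (sqrt_iter B k x - Y x)"
        using le1 by simp
      show "(\<lambda>k. norm (sqrt_iter B k x - Y x)) \<longlonglongrightarrow> 0"
        using Y LIM_zero tendsto_norm_zero by blast
    qed
    from tendsto_add [OF this Y [of "Y x"]] show ?thesis
      by (simp add: linear_diff [OF bounded_linear.linear [OF bli]])
  qed
  then have "(\<lambda>k. sqrt_iter B (Suc k) x) \<longlonglongrightarrow> (1/2) *\<^sub>R (B x + Y (Y x))" for x
    by (auto intro!: tendsto_intros)
  then have fixp: "Y x = (1/2) *\<^sub>R (B x + Y (Y x))" for x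
    using LIMSEQ_unique LIMSEQ_Suc [OF Y] by blast
  \<comment> \<open>Undoes the scaling, as (I - Y)^2 equals cA and not A.\<close>
  define r where "r = 1 / sqrt c"
  have r: "r * r * c = 1" "0 < r"
    using \<open>0 < c\<close> by (auto simp: r_def)
  define S where "S x = r *\<^sub>R (x - Y x)" for x
  have "psd S"
    unfolding psd_def
  proof (intro conjI allI)
    show "bounded_linear S"
      unfolding S_def by (intro bounded_linear_const_scaleR bounded_linear_sub bounded_linear_ident blY)
    show "S x \<bullet> y = x \<bullet> S y" for x y
      unfolding S_def by (simp add: inner_diff_left inner_diff_right saY)
    have "Y x \<bullet> x \<le> x \<bullet> x" for x
      using norm_cauchy_schwarz [of "Y x" x] mult_right_mono [OF normY, of "norm x" x]
      by (simp add: power2_norm_eq_inner [symmetric] power2_eq_square)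
    then show "0 \<le> S x \<bullet> x" for x
      using r by (simp add: S_def inner_diff_left)
  qed
  moreover have "S (S x) = A x" for x
  proof -
    have "Y (Y x) = 2 *\<^sub>R Y x - B x"
      using arg_cong [OF fixp [of x], of "\<lambda>v. 2 *\<^sub>R v"] by (simp add: algebra_simps)
    then have "x - Y x - Y (x - Y x) = c *\<^sub>R A x"
      by (simp add: Y.diff B_def scaleR_2)
    then have "S (S x) = r *\<^sub>R r *\<^sub>R c *\<^sub>R A x"
      unfolding S_def by (simp add: Y.scaleR scaleR_diff_right [symmetric])
    also have "\<dots> = A x"
      using r by (simp add: mult.assoc)
    finally show ?thesis .
  qed
  moreover have "W (S x) = S (W x)" if W: "bounded_linear W" "\<And>y. W (A y) = A (W y)" for W x
  proof -
    interpret W: bounded_linear W by fact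
    have "W (Y x) = Y (W x)"
    proof (rule LIMSEQ_unique)
      show "(\<lambda>k. W (sqrt_iter B k x)) \<longlonglongrightarrow> W (Y x)"
        by (intro W.tendsto Y)
      have "W (B x) = B (W x)" for x
        using W(2) by (simp add: B_def W.diff W.scaleR)
      then show "(\<lambda>k. W (sqrt_iter B k x)) \<longlonglongrightarrow> Y (W x)"
        using Y [of "W x"] by (simp add: sqrt_iter_commute [OF blB normB W.linear])
    qed
    then show ?thesis
      by (simp add: S_def W.scaleR W.diff)
  qed
  ultimately show thesis
    by (rule that)
qed

text \<open>With S^2 = A the form is the squared norm of \<open>S x\<close>, so \<open>S x\<close>
  vanishes and with it \<open>S (S x)\<close>.\<close>

lemma psd_kernel:
  fixes A :: "'a::{real_inner,complete_space} \<Rightarrow> 'a"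
  assumes A: "psd A" and "A x \<bullet> x = 0"
  shows "A x = 0"
proof -
  obtain S where S: "psd S" "\<And>x. S (S x) = A x"
    by (rule psd_sqrt_exists [OF A]) blast
  have "S x \<bullet> S x = 0"
    using assms(2) psdD(2) [OF S(1), of "S x" x] by (simp add: S(2))
  then have "S x = 0"
    by simp
  then show ?thesis
    using S(2) [of x] linear_0 [OF bounded_linear.linear [OF psdD(1) [OF S(1)]]] by simp
qed

text \<open>\<open>P\<close> and \<open>Q\<close> are not known to commute. The constructed root
  commutes with both, because both commute with P^2 = Q^2, and is compared with each in turn. For
  commuting roots R, S and d = (R - S)x one has (R + S)d = 0, hence Rd = Sd = 0 by positivity, and
  <d, d> = <x, (R - S)d> = 0.\<close>

theorem psd_sqrt_unique:
  fixes P :: "'a::{real_inner,complete_space} \<Rightarrow> 'a"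
  assumes P: "psd P" and Q: "psd Q" and eq: "\<And>x. P (P x) = Q (Q x)"
  shows "P = Q"
proof -
  have blP: "bounded_linear P" and blQ: "bounded_linear Q"
    using P Q by (auto dest: psdD)
  have *: "R = S" if R: "psd R" and S: "psd S" "\<And>x. R (R x) = S (S x)" "\<And>x. R (S x) = S (R x)"
    for R S :: "'a \<Rightarrow> 'a"
  proof
    fix x
    interpret R: bounded_linear R using R by (rule psdD)
    interpret S: bounded_linear S using S(1) by (rule psdD)
    define d where "d = R x - S x"
    have "R d + S d = 0"
      by (simp add: d_def R.diff S.diff S(2,3))
    then have "R d \<bullet> d + S d \<bullet> d = 0"
      by (metis inner_add_left inner_zero_left)
    then have "R d \<bullet> d = 0" "S d \<bullet> d = 0"
      using psdD(3) [OF R, of d] psdD(3) [OF S(1), of d] by linarith+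
    then have "R d = 0" "S d = 0"
      using psd_kernel R S(1) by blast+
    then have "d \<bullet> d = 0"
      unfolding d_def [of] inner_diff_left psdD(2) [OF R, of x] psdD(2) [OF S(1), of x]
      by (simp add: d_def)
    then show "R x = S x"
      by (simp add: d_def)
  qed
  have A: "psd (\<lambda>x. P (P x))"
    unfolding psd_def
    by (metis P blP bounded_linear_compose inner_ge_zero psdD(2))
  obtain S where S: "psd S" "\<And>x. S (S x) = P (P x)"
    and SW: "\<And>W x. bounded_linear W \<Longrightarrow> (\<And>x. W (P (P x)) = P (P (W x))) \<Longrightarrow> W (S x) = S (W x)"
    by (rule psd_sqrt_exists [OF A]) blast
  have "P = S"
    by (rule * [OF P S(1)]) (use S SW blP in auto)
  moreover have "Q = S"
    by (rule * [OF Q S(1)]) (use S SW [OF blQ] eq in auto)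
  ultimately show ?thesis
    by simp
qed

section \<open>Polar decomposition in real Hilbert spaces\<close>

lemma psd_inner_funpow:
  assumes "psd C"
  shows "(C ^^ k) x \<bullet> (C ^^ m) y = (C ^^ (k + m)) x \<bullet> y"
proof (induction m arbitrary: y)
  case (Suc m)
  have "(C ^^ k) x \<bullet> (C ^^ Suc m) y = (C ^^ (k + m)) x \<bullet> C y"
    by (simp only: funpow_Suc_right comp_apply Suc)
  then show ?case
    by (simp add: psdD(2) [OF assms])
qed simp

text \<open>Half of the powers are moved to the other side: an even exponent reduces to C \<le> I
  and an odd one to C^2 \<le> C, both at \<open>(C ^^ j) x\<close>.\<close>

lemma psd_funpow_Suc_le:
  assumes C: "psd C" and le: "\<And>x. C x \<bullet> x \<le> x \<bullet> x"
  shows "(C ^^ Suc k) x \<bullet> x \<le> (C ^^ k) x \<bullet> x"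
proof -
  obtain j where "k = j + j \<or> k = Suc (j + j)"
    by (metis add_Suc_right mult_2 oddE evenE Suc_eq_plus1)
  then show ?thesis
  proof
    assume k: "k = j + j"
    have "(C ^^ Suc k) x \<bullet> x = C ((C ^^ j) x) \<bullet> (C ^^ j) x"
      using psd_inner_funpow [OF C, of "Suc j" x j x] by (simp add: k)
    moreover have "(C ^^ k) x \<bullet> x = (C ^^ j) x \<bullet> (C ^^ j) x"
      using psd_inner_funpow [OF C, of j x j x] by (simp add: k)
    ultimately show ?thesis
      using le by simp
  next
    assume k: "k = Suc (j + j)"
    have "(C ^^ Suc k) x \<bullet> x = C ((C ^^ j) x) \<bullet> C ((C ^^ j) x)"
      using psd_inner_funpow [OF C, of "Suc j" x "Suc j" x] by (simp add: k)
    moreover have "(C ^^ k) x \<bullet> x = C ((C ^^ j) x) \<bullet> (C ^^ j) x"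
      using psd_inner_funpow [OF C, of "Suc j" x j x] by (simp add: k)
    ultimately show ?thesis
      using psd_contraction [OF C le] by simp
  qed
qed

text \<open>
  Since \<open>\<parallel>C\<^sup>k x - C\<^sup>m x\<parallel>\<^sup>2 = a\<^bsub>2k\<^esub> - 2 a\<^bsub>k+m\<^esub> + a\<^bsub>2m\<^esub>\<close> for \<open>a\<^sub>k = \<langle>C\<^sup>k x, x\<rangle>\<close>, it is enough
  that \<open>a\<close> decreases and is bounded below.
\<close>

lemma psd_funpow_convergent:
  fixes C :: "'a::{real_inner,complete_space} \<Rightarrow> 'a"
  assumes C: "psd C" and le: "\<And>x. C x \<bullet> x \<le> x \<bullet> x"
  shows "convergent (\<lambda>k. (C ^^ k) x)"
proof -
  define a where "a k = (C ^^ k) x \<bullet> x" for k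
  have dec: "decseq a"
    unfolding a_def by (rule decseq_SucI) (rule psd_funpow_Suc_le [OF C le])
  have "0 \<le> a k" for k
  proof -
    \<comment> \<open>Even terms are squared norms, and \<open>a k\<close> dominates
      \<open>a (k + k)\<close>.\<close>
    have "0 \<le> a (k + k)"
      unfolding a_def psd_inner_funpow [OF C, symmetric] by simp
    then show ?thesis
      using decseqD [OF dec, of k "k + k"] by simp
  qed
  then have "Cauchy a"
    using decseq_convergent [OF dec] by (metis convergentI Cauchy_convergent_iff)
  have dist_eq: "(norm ((C ^^ k) x - (C ^^ m) x))\<^sup>2 = (a (k + k) - a (k + m)) + (a (m + m) - a (k + m))"
    for k m
    unfolding a_def power2_norm_eq_inner psd_inner_funpow [OF C, symmetric]
    by (simp add: inner_diff_left inner_diff_right inner_commute)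
  have "Cauchy (\<lambda>k. (C ^^ k) x)"
  proof (rule metric_CauchyI)
    fix e :: real assume "0 < e"
    then obtain N where N: "\<And>i j. i \<ge> N \<Longrightarrow> j \<ge> N \<Longrightarrow> \<bar>a i - a j\<bar> < e\<^sup>2 / 2"
      using metric_CauchyD [OF \<open>Cauchy a\<close>, of "e\<^sup>2 / 2"] by (auto simp: dist_real_def)
    have "dist ((C ^^ k) x) ((C ^^ m) x) < e" if "N \<le> k" "N \<le> m" for k m
    proof -
      have "(norm ((C ^^ k) x - (C ^^ m) x))\<^sup>2 < e\<^sup>2"
        using N [of "k + k" "k + m"] N [of "m + m" "k + m"] that unfolding dist_eq by linarith
      then show ?thesis
        using \<open>0 < e\<close> by (simp add: dist_norm power_less_imp_less_base)
    qed
    then show "\<exists>M. \<forall>m\<ge>M. \<forall>n\<ge>M. dist ((C ^^ m) x) ((C ^^ n) x) < e"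
      by blast
  qed
  then show ?thesis
    by (simp add: Cauchy_convergent_iff)
qed

text \<open>
  With \<open>C = I - c Q\<close>, the powers \<open>C\<^sup>k\<close> converge strongly to the projection \<open>E\<close> onto the kernel of
  \<open>Q\<close>, and \<open>H\<^sub>k = c (I + C + \<dots> + C\<^bsup>k-1\<^esup>)\<close> satisfies \<open>Q H\<^sub>k = I - C\<^sup>k\<close>.  Hence \<open>\<parallel>T H\<^sub>k x\<parallel> = \<parallel>Q H\<^sub>k x\<parallel>\<close>
  makes \<open>T H\<^sub>k\<close> converge strongly, and its limit \<open>V\<close> inherits every commutation relation.
\<close>

theorem real_polar:
  fixes T Q :: "'a::{real_inner,complete_space} \<Rightarrow> 'a"
  assumes T: "bounded_linear T" and Q: "psd Q" and eq: "\<And>x. norm (T x) = norm (Q x)"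
  obtains V E where "bounded_linear V" and "bounded_linear E"
    and "\<And>x. V (Q x) = T x" and "\<And>x. Q x = 0 \<Longrightarrow> V x = 0"
    and "\<And>x. norm (V x) = norm (x - E x)" and "\<And>x. V x \<in> closure (range T)"
    and "\<And>x. x - E x \<in> closure (range Q)" and "\<And>x. Q (E x) = 0" and "\<And>x. Q x = 0 \<Longrightarrow> E x = x"
    and "\<And>x y. E x \<bullet> y = x \<bullet> E y"
    and "\<And>W x. bounded_linear W \<Longrightarrow> (\<And>y. W (T y) = T (W y)) \<Longrightarrow> (\<And>y. W (Q y) = Q (W y))
        \<Longrightarrow> W (V x) = V (W x)"
    and "\<And>W x. bounded_linear W \<Longrightarrow> (\<And>y. W (Q y) = Q (W y)) \<Longrightarrow> W (E x) = E (W x)"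
proof -
  interpret T: bounded_linear T by fact
  interpret Q: bounded_linear Q using Q by (rule psdD)
  obtain c where "0 < c" and c: "\<And>x. c * (Q x \<bullet> x) \<le> x \<bullet> x"
    using psd_scale_le [OF Q] by blast
  define C where "C x = x - c *\<^sub>R Q x" for x
  have "bounded_linear C"
    unfolding C_def
    by (intro bounded_linear_sub bounded_linear_ident bounded_linear_const_scaleR Q.bounded_linear)
  then interpret C: bounded_linear C .
  have psdC: "psd C"
    unfolding psd_def using c C.bounded_linear
    by (auto simp: C_def inner_diff_left inner_diff_right psdD(2) [OF Q])
  have leC: "C x \<bullet> x \<le> x \<bullet> x" for x
    using \<open>0 < c\<close> psdD(3) [OF Q, of x] by (simp add: C_def inner_diff_left)
  define P where "P k x = (C ^^ k) x" for k x
  have P_simps: "P 0 x = x" "P (Suc k) x = C (P k x)" for k x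
    by (simp_all add: P_def)
  have blP: "bounded_linear (P k)" for k
  proof (induction k)
    case 0
    show ?case
      unfolding P_def by (simp add: bounded_linear_ident)
  next
    case (Suc k)
    show ?case
      unfolding P_simps by (rule bounded_linear_compose [OF C.bounded_linear Suc])
  qed
  have norm_C: "norm (C x) \<le> norm x" for x
    unfolding norm_le using psd_contraction [OF psdC leC, of x] leC [of x] by simp
  have norm_P: "norm (P k x) \<le> norm x * 1" for k x
    by (induction k) (auto simp: P_simps intro: order_trans [OF norm_C])
  have P_sa: "P k x \<bullet> y = x \<bullet> P k y" for k x y
    using psd_inner_funpow [OF psdC, of 0 x k y] by (simp add: P_def)
  have P_comm: "W (P k x) = P k (W x)"
    if "bounded_linear W" "\<And>y. W (Q y) = Q (W y)" for W k x
  proof -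
    interpret W: bounded_linear W by fact
    show ?thesis
      by (induction k) (simp_all add: P_simps C_def W.diff W.scaleR that)
  qed
  have P_ker: "P k x = x" if "Q x = 0" for k x
    by (induction k) (simp_all add: P_simps C_def that)
  define E where "E x = lim (\<lambda>k. P k x)" for x
  have E: "(\<lambda>k. P k x) \<longlonglongrightarrow> E x" for x
    unfolding E_def P_def using psd_funpow_convergent [OF psdC leC] by (simp add: convergent_LIMSEQ_iff)
  note blE = bounded_linear_LIMSEQ(1) [OF blP norm_P E]
  have QE: "Q (E x) = 0" for x
  proof -
    \<comment> \<open>A limit of powers is fixed by C, and the fixed vectors of I - cQ form the
      kernel of Q.\<close>
    have "(\<lambda>k. P (Suc k) x) \<longlonglongrightarrow> C (E x)"
      unfolding P_simps by (intro C.tendsto E)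
    then have "C (E x) = E x"
      using LIMSEQ_unique LIMSEQ_Suc [OF E] by blast
    then show ?thesis
      using \<open>0 < c\<close> by (simp add: C_def)
  qed
  define H where "H k x = c *\<^sub>R (\<Sum>j<k. P j x)" for k x
  have blH: "bounded_linear (H k)" for k
    unfolding H_def by (intro bounded_linear_const_scaleR bounded_linear_sum blP)
  have QH: "Q (H k x) = x - P k x" for k x
  proof (induction k)
    case 0
    show ?case
      by (simp add: H_def P_simps Q.zero)
  next
    case (Suc k)
    have "H (Suc k) x = H k x + c *\<^sub>R P k x"
      by (simp add: H_def scaleR_add_right)
    then show ?case
      by (simp add: Suc Q.add Q.scaleR P_simps C_def)
  qed
  have H_comm: "W (H k x) = H k (W x)"
    if W: "bounded_linear W" "\<And>y. W (Q y) = Q (W y)" for W k x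
  proof -
    interpret W: bounded_linear W by fact
    show ?thesis
      by (simp add: H_def W.scaleR W.sum P_comm [OF W])
  qed
  define V where "V x = lim (\<lambda>k. T (H k x))" for x
  have V: "(\<lambda>k. T (H k x)) \<longlonglongrightarrow> V x" for x
  proof -
    have "dist (T (H k x)) (T (H m x)) = dist (P m x) (P k x)" for k m
      unfolding dist_norm T.diff [symmetric] eq by (simp add: Q.diff QH)
    moreover have "Cauchy (\<lambda>k. P k x)"
      using E by (rule LIMSEQ_imp_Cauchy)
    ultimately have "Cauchy (\<lambda>k. T (H k x))"
      by (simp add: Cauchy_def) (metis dist_commute)
    then show ?thesis
      by (simp add: V_def Cauchy_convergent_iff convergent_LIMSEQ_iff)
  qed
  have lim_sub: "(\<lambda>k. x - P k x) \<longlonglongrightarrow> x - E x" for x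
    by (intro tendsto_intros E)
  have norm_TH: "norm (T (H k x)) \<le> norm x * 2" for k x
    using norm_triangle_ineq4 [of x "P k x"] norm_P [of k x] by (simp add: eq QH)
  have blTH: "bounded_linear (\<lambda>x. T (H k x))" for k
    by (rule bounded_linear_compose [OF T blH])
  note blV = bounded_linear_LIMSEQ(1) [OF blTH norm_TH V]
  show thesis
  proof (rule that [of V E])
    show "bounded_linear V" "bounded_linear E"
      by (fact blV blE)+
    show "V (Q x) = T x" for x
    proof (rule LIMSEQ_unique [OF V])
      \<comment> \<open>Equality of norms makes T vanish on the kernel of Q. As \<open>H k\<close>
        commutes with Q, \<open>T (H k (Q x))\<close> is \<open>T (x - P k x)\<close>.\<close>
      have "T (E x) = 0"
        using eq [of "E x"] by (simp add: QE)
      moreover have "(\<lambda>k. T (x - P k x)) \<longlonglongrightarrow> T (x - E x)"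
        by (intro T.tendsto lim_sub)
      ultimately show "(\<lambda>k. T (H k (Q x))) \<longlonglongrightarrow> T x"
        by (simp add: H_comm [OF Q.bounded_linear, symmetric] QH T.diff)
    qed
    show "V x = 0" if "Q x = 0" for x
    proof (rule LIMSEQ_unique [OF V])
      have "Q (H k x) = 0" for k
        by (simp add: QH P_ker that)
      then have "T (H k x) = 0" for k
        using eq [of "H k x"] by simp
      then show "(\<lambda>k. T (H k x)) \<longlonglongrightarrow> 0"
        by simp
    qed
    show "norm (V x) = norm (x - E x)" for x
    proof (rule LIMSEQ_unique [OF tendsto_norm [OF V]])
      show "(\<lambda>k. norm (T (H k x))) \<longlonglongrightarrow> norm (x - E x)"
        unfolding eq QH by (intro tendsto_norm lim_sub)
    qed
    show "V x \<in> closure (range T)" for x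
      unfolding closure_sequential by (rule exI [of _ "\<lambda>k. T (H k x)"]) (use V in auto)
    show "x - E x \<in> closure (range Q)" for x
      unfolding closure_sequential
    proof (intro exI conjI allI)
      show "Q (H k x) \<in> range Q" for k
        by (rule rangeI)
      show "(\<lambda>k. Q (H k x)) \<longlonglongrightarrow> x - E x"
        unfolding QH by (rule lim_sub)
    qed
    show "Q (E x) = 0" for x
      by (rule QE)
    show "E x = x" if "Q x = 0" for x
      using LIMSEQ_unique [OF E, of x x] by (simp add: P_ker that)
    show "E x \<bullet> y = x \<bullet> E y" for x y
    proof (rule LIMSEQ_unique)
      show "(\<lambda>k. P k x \<bullet> y) \<longlonglongrightarrow> E x \<bullet> y"
        by (intro tendsto_intros E)
      show "(\<lambda>k. P k x \<bullet> y) \<longlonglongrightarrow> x \<bullet> E y"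
        unfolding P_sa by (intro tendsto_intros E)
    qed
    show "W (V x) = V (W x)"
      if W: "bounded_linear W" "\<And>y. W (T y) = T (W y)" "\<And>y. W (Q y) = Q (W y)" for W x
    proof (rule LIMSEQ_unique)
      show "(\<lambda>k. W (T (H k x))) \<longlonglongrightarrow> W (V x)"
        by (intro bounded_linear.tendsto [OF W(1)] V)
      show "(\<lambda>k. W (T (H k x))) \<longlonglongrightarrow> V (W x)"
        using V [of "W x"] by (simp add: W(2) H_comm [OF W(1,3)])
    qed
    show "W (E x) = E (W x)"
      if W: "bounded_linear W" "\<And>y. W (Q y) = Q (W y)" for W x
    proof (rule LIMSEQ_unique)
      show "(\<lambda>k. W (P k x)) \<longlonglongrightarrow> W (E x)"
        by (intro bounded_linear.tendsto [OF W(1)] E)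
      show "(\<lambda>k. W (P k x)) \<longlonglongrightarrow> E (W x)"
        using E [of "W x"] by (simp add: P_comm [OF W])
    qed
  qed
qed

lemma inner_closure_range_eq_0:
  assumes "\<And>z. u \<bullet> f z = 0" and "y \<in> closure (range f)"
  shows "u \<bullet> y = 0"
proof -
  have "closure (range f) \<subseteq> {y. u \<bullet> y = 0}"
    by (rule closure_minimal) (use assms(1) closed_hyperplane in auto)
  then show ?thesis
    using assms(2) by blast
qed

lemma inner_eq_if_norm_eq:
  assumes "bounded_linear f" "bounded_linear g" "\<And>x. norm (f x) = norm (g x)"
  shows "f x \<bullet> f y = g x \<bullet> g y"
  unfolding dot_norm using assms by (simp add: linear_simps(1) [symmetric])

text \<open>x = (x - E x) + E x splits x between the closure of Ran Q and the kernel of Q;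
  \<open>real_polar\<close> with T = Q serves only to supply the projection
  \<open>E\<close>.\<close>

lemma eq_if_agree_range_kernel:
  fixes f g Q :: "'a::{real_inner,complete_space} \<Rightarrow> 'a"
  assumes Q: "psd Q" and f: "bounded_linear f" and g: "bounded_linear g"
    and range: "\<And>x. f (Q x) = g (Q x)" and kernel: "\<And>x. Q x = 0 \<Longrightarrow> f x = g x"
  shows "f = g"
proof
  fix x
  obtain E where E: "x - E x \<in> closure (range Q)" "Q (E x) = 0"
    by (rule real_polar [OF psdD(1) [OF Q] Q refl]) blast
  have "closure (range Q) \<subseteq> {y. f y = g y}"
    by (rule closure_minimal)
      (use range f g in \<open>auto intro!: closed_Collect_eq linear_continuous_on\<close>)
  then have "f (x - E x) = g (x - E x)"
    using E(1) by blast
  then show "f x = g x"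
    using kernel [OF E(2)] by (simp add: linear_simps(2) [OF f] linear_simps(2) [OF g])
qed

section \<open>Operators on Clifford modules\<close>

lemma clifford_conj_conj [simp]: "clifford_conj (clifford_conj a) = a"
  by (simp add: clifford_eq_iff coeff_clifford_conj)

lemma clifford_conj_diff: "clifford_conj (a - b) = clifford_conj a - clifford_conj b"
  by (simp add: clifford_eq_iff coeff_clifford_conj algebra_simps)

lemma clifford_conj_sum: "clifford_conj (sum f S) = (\<Sum>x\<in>S. clifford_conj (f x))"
  by (simp add: clifford_eq_iff coeff_clifford_conj coeff_sum sum_distrib_left)

lemma coeff_mult_empty: "coeff (a * b) {} = (\<Sum>A\<in>UNIV. reorder_sign A A * coeff a A * coeff b A)"
  by (simp add: coeff_mult)

lemma coeff_mult_empty_commute: "coeff (a * b) {} = coeff (b * a) {}"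
  by (simp add: coeff_mult_empty mult_ac)

lemma coeff_mult_blade_empty: "coeff (a * blade A) {} = reorder_sign A A * coeff a A"
  by (simp add: coeff_mult_empty coeff_blade if_distrib cong: if_cong)

lemma coeff_mult_gen: "coeff (a * gen i) {i} = coeff a {}"
proof -
  have "sym_diff A {i} = {i} \<longleftrightarrow> A = {}" for A
    by blast
  then show ?thesis
    by (simp add: coeff_mult coeff_blade if_distrib cong: if_cong)
qed

lemma coeff_gen_self_conj:
  assumes "clifford_conj a = a"
  shows "coeff a {i} = 0"
proof -
  have "coeff (clifford_conj a) {i} = - coeff a {i}"
    by (simp add: coeff_clifford_conj reorder_sign_def)
  then show ?thesis
    using assms by simp
qed

lemma clifford_nonneg_self_conj: "clifford_nonneg a \<Longrightarrow> clifford_conj a = a"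
  by (auto simp: clifford_nonneg_def clifford_conj_mult)

lemma clifford_nonneg_coeff_empty: "clifford_nonneg a \<Longrightarrow> 0 \<le> coeff a {}"
  by (auto simp: clifford_nonneg_def coeff_mult_empty coeff_clifford_conj mult.assoc
      mult.left_commute [of "reorder_sign _ _" "coeff _ _"] intro!: sum_nonneg)

lemma cinner_add_left: "cinner (x + y) z = cinner x z + cinner y z"
  by (simp add: cinner_def inner_add_left scaleR_add_left sum.distrib)

lemma cinner_add_right: "cinner x (y + z) = cinner x y + cinner x z"
  by (simp add: cinner_def inner_add_right scaleR_add_left sum.distrib)

lemma cinner_commute: "clifford_conj (cinner x y) = cinner y x"
proof -
  have "clifford_conj (cinner x y) =
      (\<Sum>A\<in>UNIV. \<Sum>B\<in>UNIV. (y $ B \<bullet> x $ A) *\<^sub>R (clifford_conj (blade A) * blade B))"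
    by (simp add: cinner_def clifford_conj_sum clifford_conj_scaleR clifford_conj_mult inner_commute)
  also have "\<dots> = cinner y x"
    unfolding cinner_def by (rule sum.swap)
  finally show ?thesis .
qed

lemma cinner_right_mult_right: "cinner x (right_mult y a) = clifford_conj a * cinner x y"
  by (metis cinner_commute cinner_right_mult clifford_conj_mult)

lemma coeff_cinner_empty: "coeff (cinner x y) {} = x \<bullet> y"
  for x y :: "('h::real_inner, 'n::{finite,linorder}) clifford_module"
proof -
  have *: "coeff (clifford_conj (blade B) * blade A) {} = (if A = B then 1 else 0)"
    for A B :: "'n set"
    unfolding coeff_mult_blade_empty by (simp add: coeff_clifford_conj coeff_blade)
  show ?thesis
    by (simp add: * cinner_def coeff_sum inner_vec_def if_distrib cong: if_cong)
qed

text \<open>Right multiplication by a blade moves the coefficient at that blade to the real part, up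
  to sign. The real inner product thus determines the Clifford-valued one.\<close>

lemma coeff_cinner: "coeff (cinner x y) A = reorder_sign A A * (right_mult x (blade A) \<bullet> y)"
  by (simp add: coeff_cinner_empty [symmetric] cinner_right_mult coeff_mult_blade_empty)

lemma cinner_eq_0_commute: "cinner x y = 0 \<longleftrightarrow> cinner y x = 0"
  for x y :: "('h::real_inner, 'n::{finite,linorder}) clifford_module"
proof -
  have "clifford_conj 0 = (0 :: 'n clifford)"
    by (simp add: clifford_eq_iff coeff_clifford_conj)
  then show ?thesis
    by (metis cinner_commute)
qed

lemma inner_eq_0_if_cinner_eq_0: "cinner x y = 0 \<Longrightarrow> x \<bullet> y = 0"
  by (simp add: coeff_cinner_empty [symmetric])

lemma right_mult_add_left: "right_mult (x + y) a = right_mult x a + right_mult y a"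
  by (simp add: right_mult_def vec_eq_iff scaleR_add_right sum.distrib)

lemma right_mult_scaleR_left: "right_mult (r *\<^sub>R x) a = r *\<^sub>R right_mult x a"
  by (simp add: right_mult_def vec_eq_iff scaleR_sum_right mult.commute)

text \<open>The real part is a trace on the algebra, so \<open>a\<close> may be moved across the
  product.\<close>

lemma inner_right_mult: "right_mult x a \<bullet> y = x \<bullet> right_mult y (clifford_conj a)"
  by (simp add: coeff_cinner_empty [symmetric] cinner_right_mult cinner_right_mult_right
      coeff_mult_empty_commute)

lemma bounded_linear_right_mult: "bounded_linear (\<lambda>x. right_mult x a)"
proof (rule bounded_linear_intro)
  show "right_mult (x + y) a = right_mult x a + right_mult y a" for x y :: "('a, 'b) clifford_module"
    by (rule right_mult_add_left)
  show "right_mult (r *\<^sub>R x) a = r *\<^sub>R right_mult x a" for r and x :: "('a, 'b) clifford_module"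
    by (rule right_mult_scaleR_left)
  fix x :: "('a, 'b) clifford_module"
  have "norm (right_mult x a) \<le> (\<Sum>C\<in>UNIV. norm (right_mult x a $ C))"
    unfolding norm_vec_def by (rule L2_set_le_sum) simp
  also have "\<dots> \<le> (\<Sum>C\<in>UNIV. \<Sum>A\<in>UNIV. norm x * \<bar>coeff (blade A * a) C\<bar>)"
  proof (rule sum_mono)
    fix C
    have "norm (right_mult x a $ C) \<le> (\<Sum>A\<in>UNIV. norm (coeff (blade A * a) C *\<^sub>R x $ A))"
      unfolding right_mult_def vec_lambda_beta by (rule norm_sum)
    also have "\<dots> \<le> (\<Sum>A\<in>UNIV. norm x * \<bar>coeff (blade A * a) C\<bar>)"
      by (intro sum_mono) (auto simp: mult.commute [of "\<bar>_\<bar>"] intro!: mult_right_mono Finite_Cartesian_Product.norm_nth_le)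
    finally show "norm (right_mult x a $ C) \<le> (\<Sum>A\<in>UNIV. norm x * \<bar>coeff (blade A * a) C\<bar>)" .
  qed
  finally show "norm (right_mult x a) \<le> norm x * (\<Sum>C\<in>UNIV. \<Sum>A\<in>UNIV. \<bar>coeff (blade A * a) C\<bar>)"
    by (simp add: sum_distrib_left)
qed

section \<open>Clifford positivity and adjoints from their real counterparts\<close>

lemma bounded_opD:
  assumes "bounded_op T"
  shows "bounded_linear T" "T (right_mult x a) = right_mult (T x) a"
  using assms by (auto simp: bounded_op_def)

lemma bounded_op_comp: "bounded_op S \<Longrightarrow> bounded_op T \<Longrightarrow> bounded_op (S \<circ> T)"
  by (auto simp: bounded_op_def comp_def intro: bounded_linear_compose)

text \<open>A vector \<open>v\<close> over the scalars \<open>\<real>\<close> stands for the Clifford number with coefficients \<open>v $ A\<close>.\<close>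

lemma right_mult_real:
  "right_mult v a = (\<chi> C. coeff (Clifford (($) v) * a) C)"
  for v :: "(real, 'n::{finite,linorder}) clifford_module"
proof -
  have "coeff (Clifford (($) v) * a) C = (\<Sum>A\<in>UNIV. coeff (blade A * a) C * v $ A)" for C
    by (subst clifford_expand [of "Clifford (($) v)"])
      (simp add: sum_distrib_right coeff_sum mult.commute)
  then show ?thesis
    by (simp add: right_mult_def)
qed

lemma inner_real_clifford:
  "v \<bullet> w = coeff (clifford_conj (Clifford (($) w)) * Clifford (($) v)) {}"
  for v w :: "(real, 'n::{finite,linorder}) clifford_module"
  by (simp add: inner_vec_def coeff_mult_empty coeff_clifford_conj mult_ac)

text \<open>
  Left multiplication by \<open>c = \<langle>y, y\<rangle>\<close> on \<open>\<real>\<^sub>n\<close> is positive semidefinite, since the real part of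
  \<open>clifford_conj v * c * v\<close> is \<open>\<parallel>y v\<parallel>\<^sup>2\<close>.  Its square root commutes with right multiplications, so
  it is left multiplication by some self-conjugate \<open>b\<close>, and \<open>c = b\<^sup>2\<close>.
\<close>

lemma clifford_nonneg_cinner: "clifford_nonneg (cinner y y)"
  for y :: "('h::real_inner, 'n::{finite,linorder}) clifford_module"
proof -
  define c where "c = cinner y y"
  have c: "clifford_conj c = c"
    unfolding c_def by (rule cinner_commute)
  define \<phi> where "\<phi> v = Clifford (($) v)" for v :: "(real, 'n) clifford_module"
  define \<psi> where "\<psi> a = (\<chi> A. coeff a A)" for a :: "'n clifford"
  have \<phi>\<psi> [simp]: "\<phi> (\<psi> a) = a" for a
    by (simp add: \<phi>_def \<psi>_def clifford_eq_iff)
  have \<psi>\<phi> [simp]: "\<psi> (\<phi> v) = v" for v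
    by (simp add: \<phi>_def \<psi>_def)
  have rm: "right_mult v a = \<psi> (\<phi> v * a)" for v a
    by (simp add: right_mult_real \<phi>_def \<psi>_def)
  have inner: "v \<bullet> w = coeff (clifford_conj (\<phi> w) * \<phi> v) {}" for v w
    by (simp add: inner_real_clifford \<phi>_def)
  define L where "L v = \<psi> (c * \<phi> v)" for v
  have \<phi>_linear: "\<phi> (v + w) = \<phi> v + \<phi> w" "\<phi> (r *\<^sub>R v) = r *\<^sub>R \<phi> v" for v w r
    by (simp_all add: \<phi>_def clifford_eq_iff)
  have \<psi>_linear: "\<psi> (a + b) = \<psi> a + \<psi> b" "\<psi> (r *\<^sub>R a) = r *\<^sub>R \<psi> a" for a b r
    by (simp_all add: \<psi>_def vec_eq_iff)
  have "linear L"
    by (rule linearI) (simp_all add: L_def \<phi>_linear \<psi>_linear algebra_simps)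
  have "psd L"
    unfolding psd_def
  proof (intro conjI allI)
    show "bounded_linear L"
      using \<open>linear L\<close> by (simp add: linear_conv_bounded_linear)
    show "L v \<bullet> w = v \<bullet> L w" for v w
      by (simp add: inner L_def clifford_conj_mult c mult.assoc)
    show "0 \<le> L v \<bullet> v" for v
    proof -
      have "L v \<bullet> v = coeff (cinner (right_mult y (\<phi> v)) (right_mult y (\<phi> v))) {}"
        by (simp add: inner L_def cinner_right_mult cinner_right_mult_right c_def mult.assoc)
      then show ?thesis
        by (simp add: coeff_cinner_empty)
    qed
  qed
  then obtain S where S: "psd S" "\<And>v. S (S v) = L v"
    and comm: "\<And>W v. bounded_linear W \<Longrightarrow> (\<And>v. W (L v) = L (W v)) \<Longrightarrow> W (S v) = S (W v)"
    by (rule psd_sqrt_exists) blast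
  have S_right: "right_mult (S v) a = S (right_mult v a)" for v a
    by (rule comm [OF bounded_linear_right_mult]) (simp add: rm L_def mult.assoc)
  define b where "b = \<phi> (S (\<psi> 1))"
  have Sb: "S (\<psi> a) = \<psi> (b * a)" for a
    using S_right [of "\<psi> 1" a] by (simp add: rm b_def)
  have "b * b = c"
  proof -
    have "\<psi> (b * b) = \<psi> c"
      using S(2) [of "\<psi> 1"] by (simp add: Sb L_def)
    then show ?thesis
      by (metis \<phi>\<psi>)
  qed
  have "coeff b A = coeff (clifford_conj b) A" for A
  proof -
    \<comment> \<open>Symmetry of \<open>S\<close> between 1 and the conjugate of a blade compares
      the coefficients of \<open>b\<close> and \<open>clifford_conj b\<close> at that blade, up to a
      common sign.\<close>
    have "S (\<psi> 1) \<bullet> \<psi> (clifford_conj (blade A)) = \<psi> 1 \<bullet> S (\<psi> (clifford_conj (blade A)))"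
      by (rule psdD [OF S(1)])
    then have "coeff (blade A * b) {} = coeff (blade A * clifford_conj b) {}"
      by (simp add: Sb inner clifford_conj_mult)
    then have "reorder_sign A A * coeff b A = reorder_sign A A * coeff (clifford_conj b) A"
      unfolding coeff_mult_empty_commute [of "blade A"] coeff_mult_blade_empty .
    then show ?thesis
      by (metis reorder_sign_square_left)
  qed
  then have "clifford_conj b = b"
    by (simp add: clifford_eq_iff)
  then show ?thesis
    unfolding clifford_nonneg_def c_def [symmetric] using \<open>b * b = c\<close> by (intro exI [of _ b]) simp
qed

text \<open>Each coefficient of \<open>cinner (T x) y\<close> is, up to sign, a real inner product
  with x replaced by x times a blade; right linearity of \<open>T\<close> lets the real identity
  apply there.\<close>

lemma cinner_adjointI:
  assumes "bounded_op T" and "\<And>x y. T x \<bullet> y = x \<bullet> S y"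
  shows "cinner (T x) y = cinner x (S y)"
  by (simp add: clifford_eq_iff coeff_cinner bounded_opD(2) [OF assms(1), symmetric] assms(2))

text \<open>
  Polarisation shows that \<open>q(x, y) = \<langle>T x, y\<rangle> - \<langle>x, T y\<rangle>\<close> is self-conjugate for all \<open>x\<close>, \<open>y\<close>; then so is
  \<open>q(x, y) e\<^sub>i = q(x e\<^sub>i, y)\<close>, whose coefficient at \<open>e\<^sub>i\<close> is the real part of \<open>q(x, y)\<close>.
\<close>

lemma positive_op_self_adjoint:
  fixes T :: "('h::real_inner, 'n::{finite,linorder}) clifford_op"
  assumes "positive_op T"
  shows "T x \<bullet> y = x \<bullet> T y"
proof -
  have T: "bounded_op T" and pos: "clifford_nonneg (cinner (T x) x)" for x
    using assms by (auto simp: positive_op_def)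
  interpret T: bounded_linear T
    using T by (rule bounded_opD)
  define q where "q x y = cinner (T x) y - cinner x (T y)" for x y
  have q_conj: "clifford_conj (q x y) = - q y x" for x y
    by (simp add: q_def clifford_conj_diff cinner_commute)
  have q_diag: "q x x = 0" for x
    using clifford_nonneg_self_conj [OF pos, of x] by (simp add: q_def cinner_commute)
  have "q (x + y) (x + y) = q x x + q x y + q y x + q y y" for x y
    by (simp add: q_def T.add cinner_add_left cinner_add_right)
  then have "q x y = - q y x" for x y
    by (simp add: q_diag eq_neg_iff_add_eq_0)
  then have self_conj: "clifford_conj (q x y) = q x y" for x y
    using q_conj by metis
  have "q (right_mult x a) y = q x y * a" for x y a
    by (simp add: q_def bounded_opD(2) [OF T] cinner_right_mult algebra_simps)
  then have "coeff (q x y * gen i) {i} = 0" for i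
    using coeff_gen_self_conj self_conj by metis
  then have "coeff (q x y) {} = 0"
    by (simp add: coeff_mult_gen)
  then show ?thesis
    by (simp add: q_def coeff_cinner_empty)
qed

lemma positive_op_psd:
  assumes "positive_op T"
  shows "psd T"
  unfolding psd_def
proof (intro conjI allI)
  have T: "bounded_op T" and pos: "clifford_nonneg (cinner (T x) x)" for x
    using assms by (auto simp: positive_op_def)
  show "bounded_linear T"
    using T by (rule bounded_opD)
  show "T x \<bullet> y = x \<bullet> T y" for x y
    by (rule positive_op_self_adjoint [OF assms])
  show "0 \<le> T x \<bullet> x" for x
    using clifford_nonneg_coeff_empty [OF pos] by (simp add: coeff_cinner_empty)
qed

text \<open>The real inequality sees only the real part of \<open>cinner (T x) x\<close>. Writing T
  = S^2 with \<open>S\<close> Clifford-linear turns the whole value into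
  \<open>cinner (S x) (S x)\<close>.\<close>

lemma psd_positive_op:
  fixes T :: "('h::{real_inner,complete_space}, 'n::{finite,linorder}) clifford_op"
  assumes "bounded_op T" and "psd T"
  shows "positive_op T"
proof -
  obtain S where S: "psd S" "\<And>x. S (S x) = T x"
    and comm: "\<And>W x. bounded_linear W \<Longrightarrow> (\<And>x. W (T x) = T (W x)) \<Longrightarrow> W (S x) = S (W x)"
    by (rule psd_sqrt_exists [OF assms(2)]) blast
  have "bounded_op S"
    unfolding bounded_op_def using psdD(1) [OF S(1)] comm [OF bounded_linear_right_mult]
    by (simp add: bounded_opD(2) [OF assms(1)])
  then have "cinner (T x) x = cinner (S x) (S x)" for x
    unfolding S(2) [symmetric] by (rule cinner_adjointI) (rule psdD [OF S(1)])
  then show ?thesis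
    by (simp add: positive_op_def assms(1) clifford_nonneg_cinner)
qed

text \<open>Real parts alone determine the adjoint, so the real adjoint is the only candidate. It is
  right linear because right multiplication by \<open>a\<close> has right multiplication by
  \<open>clifford_conj a\<close> as its adjoint.\<close>

lemma adj_properties:
  fixes T :: "('h::{real_inner,complete_space}, 'n::{finite,linorder}) clifford_op"
  assumes T: "bounded_op T"
  shows bounded_op_adj: "bounded_op (adj T)"
    and inner_adj: "T x \<bullet> y = x \<bullet> adj T y"
proof -
  note bl = bounded_opD(1) [OF T]
  note inner = inner_adjoint [OF bl]
  have right: "adjoint T (right_mult y a) = right_mult (adjoint T y) a" for y a
  proof (rule vector_eq_ldot [THEN iffD1, rule_format])
    fix x
    have "x \<bullet> adjoint T (right_mult y a) = right_mult (T x) (clifford_conj a) \<bullet> y"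
      by (simp add: inner [symmetric] inner_right_mult)
    also have "\<dots> = x \<bullet> right_mult (adjoint T y) a"
      by (simp add: bounded_opD(2) [OF T, symmetric] inner inner_right_mult)
    finally show "x \<bullet> adjoint T (right_mult y a) = x \<bullet> right_mult (adjoint T y) a" .
  qed
  have "bounded_op (adjoint T)"
    unfolding bounded_op_def using bounded_linear_adjoint [OF bl] right by blast
  moreover have "cinner (T x) y = cinner x (adjoint T y)" for x y
    by (rule cinner_adjointI [OF T]) (rule inner)
  moreover have "S = adjoint T" if "\<And>x y. cinner (T x) y = cinner x (S y)" for S
    by (rule adjoint_unique [symmetric]) (simp add: coeff_cinner_empty [symmetric] that)
  ultimately have "adj T = adjoint T"
    unfolding adj_def by (intro the_equality conjI allI) blast+
  then show "bounded_op (adj T)" "T x \<bullet> y = x \<bullet> adj T y"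
    using \<open>bounded_op (adjoint T)\<close> inner by simp_all
qed

section \<open>Polar decomposition of Clifford operators\<close>

lemma inner_adj_left:
  fixes T :: "('h::{real_inner,complete_space}, 'n::{finite,linorder}) clifford_op"
  assumes "bounded_op T"
  shows "adj T x \<bullet> y = x \<bullet> T y"
  using inner_adj [OF assms, of y x] by (simp add: inner_commute)

text \<open>Together with the next lemma this puts \<open>adj U\<close> among the operators
  commuting with \<open>T\<close> and \<open>adj T\<close>.\<close>

lemma adj_commute:
  fixes S T :: "('h::{real_inner,complete_space}, 'n::{finite,linorder}) clifford_op"
  assumes "bounded_op S" "bounded_op T" and comm: "\<And>x. S (adj T x) = adj T (S x)"
  shows "adj S (T x) = T (adj S x)"
proof (rule vector_eq_ldot [THEN iffD1, rule_format])
  fix z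
  show "z \<bullet> adj S (T x) = z \<bullet> T (adj S x)"
    by (simp add: inner_adj [OF assms(1), symmetric] inner_adj_left [OF assms(2), symmetric] comm)
qed

lemma adj_commute_adj:
  fixes S T :: "('h::{real_inner,complete_space}, 'n::{finite,linorder}) clifford_op"
  assumes "bounded_op S" "bounded_op T" and comm: "\<And>x. S (T x) = T (S x)"
  shows "adj S (adj T x) = adj T (adj S x)"
proof (rule vector_eq_ldot [THEN iffD1, rule_format])
  fix z
  show "z \<bullet> adj S (adj T x) = z \<bullet> adj T (adj S x)"
    by (simp add: inner_adj [OF assms(1), symmetric] inner_adj [OF assms(2), symmetric] comm)
qed

lemma psd_adj_comp:
  fixes T :: "('h::{real_inner,complete_space}, 'n::{finite,linorder}) clifford_op"
  assumes T: "bounded_op T"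
  shows "psd (adj T \<circ> T)"
  unfolding psd_def using bounded_opD(1) [OF bounded_op_comp [OF bounded_op_adj [OF T] T]]
  by (simp add: inner_adj_left [OF T] inner_adj [OF T, symmetric])

lemma abs_op_ex1:
  fixes T :: "('h::{real_inner,complete_space}, 'n::{finite,linorder}) clifford_op"
  assumes T: "bounded_op T"
  shows "\<exists>!Q. positive_op Q \<and> Q \<circ> Q = adj T \<circ> T"
proof -
  have TT: "bounded_op (adj T \<circ> T)"
    by (intro bounded_op_comp bounded_op_adj T)
  obtain S where S: "psd S" "\<And>x. S (S x) = (adj T \<circ> T) x"
    and comm: "\<And>W x. bounded_linear W \<Longrightarrow> (\<And>y. W ((adj T \<circ> T) y) = (adj T \<circ> T) (W y)) \<Longrightarrow>
      W (S x) = S (W x)"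
    by (rule psd_sqrt_exists [OF psd_adj_comp [OF T]]) blast
  have "bounded_op S"
    unfolding bounded_op_def using psdD(1) [OF S(1)] comm [OF bounded_linear_right_mult]
    by (simp only: bounded_opD(2) [OF TT] simp_thms)
  then have "positive_op S"
    using S(1) by (rule psd_positive_op)
  show ?thesis
  proof (rule ex1I [of _ S])
    show "positive_op S \<and> S \<circ> S = adj T \<circ> T"
      using \<open>positive_op S\<close> S(2) by auto
    show "Q = S" if "positive_op Q \<and> Q \<circ> Q = adj T \<circ> T" for Q
    proof (rule psd_sqrt_unique [OF positive_op_psd S(1)])
      show "positive_op Q"
        using that by blast
      show "Q (Q x) = S (S x)" for x
        using that S(2) by (metis comp_apply)
    qed
  qed
qed

lemma
  fixes T :: "('h::{real_inner,complete_space}, 'n::{finite,linorder}) clifford_op"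
  assumes T: "bounded_op T"
  shows positive_abs_op: "positive_op (abs_op T)"
    and abs_op_square: "abs_op T (abs_op T x) = adj T (T x)"
    and abs_op_unique: "positive_op Q \<Longrightarrow> (\<And>x. Q (Q x) = adj T (T x)) \<Longrightarrow> Q = abs_op T"
proof -
  have "positive_op (abs_op T) \<and> abs_op T \<circ> abs_op T = adj T \<circ> T"
    unfolding abs_op_def sqrt_op_def by (rule theI' [OF abs_op_ex1 [OF T]])
  then show 1: "positive_op (abs_op T)" "abs_op T (abs_op T x) = adj T (T x)" for x
    by (simp_all add: fun_eq_iff)
  show "Q = abs_op T" if "positive_op Q" "\<And>x. Q (Q x) = adj T (T x)"
    by (rule psd_sqrt_unique) (use that 1 positive_op_psd in auto)
qed

section \<open>The modulus and its polar factors\<close>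

context
  fixes T :: "('h::{real_inner,complete_space}, 'n::{finite,linorder}) clifford_op"
  assumes T: "bounded_op T"
begin

interpretation T: bounded_linear T
  using T by (rule bounded_opD)

lemma bounded_abs_op: "bounded_op (abs_op T)"
  using positive_abs_op [OF T] by (simp add: positive_op_def)

lemma psd_abs_op: "psd (abs_op T)"
  by (rule positive_op_psd [OF positive_abs_op [OF T]])

lemma norm_abs_op: "norm (T x) = norm (abs_op T x)"
  by (simp add: norm_eq_sqrt_inner inner_adj [OF T] psdD(2) [OF psd_abs_op] abs_op_square [OF T])

text \<open>Uniqueness identifies \<open>abs_op T\<close> with the root built as a limit, which
  carries the commutation property.\<close>

lemma abs_op_commute:
  assumes "bounded_linear W" and "\<And>x. W (adj T (T x)) = adj T (T (W x))"
  shows "W (abs_op T x) = abs_op T (W x)"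
proof -
  obtain S where S: "psd S" "\<And>x. S (S x) = (adj T \<circ> T) x"
    and comm: "\<And>W x. bounded_linear W \<Longrightarrow> (\<And>y. W ((adj T \<circ> T) y) = (adj T \<circ> T) (W y)) \<Longrightarrow>
      W (S x) = S (W x)"
    by (rule psd_sqrt_exists [OF psd_adj_comp [OF T]]) blast
  have "S = abs_op T"
    by (rule psd_sqrt_unique [OF S(1) psd_abs_op]) (simp add: S(2) abs_op_square [OF T])
  then show ?thesis
    using comm [OF assms(1)] assms(2) by simp
qed

text \<open>With Q = |T|, testing x against Q(Qx) gives the squared norm of Qx. Conversely, Clifford
  orthogonality needs every coefficient, so the argument runs over all
  \<open>right_mult x a\<close>, which stay in the kernel.\<close>

lemma orth_compl_range_abs_op: "orth_compl (closure (range (abs_op T))) = op_kernel (abs_op T)"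
proof (intro set_eqI iffI)
  fix x assume "x \<in> orth_compl (closure (range (abs_op T)))"
  moreover have "abs_op T (abs_op T x) \<in> closure (range (abs_op T))"
    by (rule subsetD [OF closure_subset rangeI])
  ultimately have "cinner x (abs_op T (abs_op T x)) = 0"
    by (simp add: orth_compl_def)
  then have "abs_op T x \<bullet> abs_op T x = 0"
    using inner_eq_0_if_cinner_eq_0 [of x "abs_op T (abs_op T x)"] by (simp add: psdD(2) [OF psd_abs_op])
  then show "x \<in> op_kernel (abs_op T)"
    by (simp add: op_kernel_def)
next
  interpret Q: bounded_linear "abs_op T"
    by (rule psdD [OF psd_abs_op])
  fix x assume x: "x \<in> op_kernel (abs_op T)"
  have "right_mult x a \<bullet> abs_op T z = 0" for a z
  proof -
    have "abs_op T (right_mult x a) = right_mult 0 a"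
      using x by (simp add: op_kernel_def bounded_opD(2) [OF bounded_abs_op])
    then show ?thesis
      by (simp add: psdD(2) [OF psd_abs_op, symmetric]
          linear_0 [OF bounded_linear.linear [OF bounded_linear_right_mult]])
  qed
  then have "right_mult x a \<bullet> y = 0" if "y \<in> closure (range (abs_op T))" for a y
    using that by (rule inner_closure_range_eq_0)
  then show "x \<in> orth_compl (closure (range (abs_op T)))"
    by (simp add: orth_compl_def clifford_eq_iff coeff_cinner)
qed

text \<open>The projection \<open>E\<close> is exported too: adding it to the partial isometry
  yields the unitary factor in the normal case.\<close>

lemma polar_decomposition_obtain:
  obtains V E where "polar_decomposition T V (abs_op T)" and "bounded_op V" and "bounded_op E"
    and "\<And>x. V (abs_op T x) = T x"
    and "\<And>x. norm (V x) = norm (x - E x)" and "\<And>x. V x \<in> closure (range T)"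
    and "\<And>x. abs_op T (E x) = 0" and "\<And>x. abs_op T x = 0 \<Longrightarrow> E x = x"
    and "\<And>x y. E x \<bullet> y = x \<bullet> E y"
    and "\<And>W x. bounded_linear W \<Longrightarrow> (\<And>y. W (T y) = T (W y)) \<Longrightarrow>
        (\<And>y. W (abs_op T y) = abs_op T (W y)) \<Longrightarrow> W (V x) = V (W x)"
    and "\<And>W x. bounded_linear W \<Longrightarrow> (\<And>y. W (abs_op T y) = abs_op T (W y)) \<Longrightarrow> W (E x) = E (W x)"
proof (rule real_polar [OF bounded_opD(1) [OF T] psd_abs_op norm_abs_op])
  fix V E
  assume blV: "bounded_linear V" and blE: "bounded_linear E"
    and VQ: "\<And>x. V (abs_op T x) = T x" and V_ker: "\<And>x. abs_op T x = 0 \<Longrightarrow> V x = 0"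
    and norm_V: "\<And>x. norm (V x) = norm (x - E x)" and V_ran: "\<And>x. V x \<in> closure (range T)"
    and QE: "\<And>x. abs_op T (E x) = 0" and E_ker: "\<And>x. abs_op T x = 0 \<Longrightarrow> E x = x"
    and E_sa: "\<And>x y. E x \<bullet> y = x \<bullet> E y"
    and V_comm: "\<And>W x. bounded_linear W \<Longrightarrow> (\<And>y. W (T y) = T (W y)) \<Longrightarrow>
        (\<And>y. W (abs_op T y) = abs_op T (W y)) \<Longrightarrow> W (V x) = V (W x)"
    and E_comm: "\<And>W x. bounded_linear W \<Longrightarrow> (\<And>y. W (abs_op T y) = abs_op T (W y)) \<Longrightarrow>
        W (E x) = E (W x)"
  have "right_mult (V x) a = V (right_mult x a)" for x a
    by (rule V_comm [OF bounded_linear_right_mult])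
      (simp_all add: bounded_opD(2) [OF T] bounded_opD(2) [OF bounded_abs_op])
  then have V: "bounded_op V"
    by (simp add: bounded_op_def blV)
  have "right_mult (E x) a = E (right_mult x a)" for x a
    by (rule E_comm [OF bounded_linear_right_mult]) (simp add: bounded_opD(2) [OF bounded_abs_op])
  then have E: "bounded_op E"
    by (simp add: bounded_op_def blE)
  have ker: "op_kernel V = op_kernel (abs_op T)"
  proof -
    have "abs_op T x = 0" if "V x = 0" for x
    proof -
      have "x = E x"
        using norm_V [of x] that by simp
      then show ?thesis
        using QE by metis
    qed
    then show ?thesis
      unfolding op_kernel_def using V_ker by blast
  qed
  have "norm (V x) = norm x" if "x \<in> orth_compl (op_kernel V)" for x
  proof -
    \<comment> \<open>\<open>E x\<close> lies in the kernel, so x is orthogonal to it; as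
      \<open>E\<close> is a symmetric projection, this makes \<open>E x\<close> vanish.\<close>
    have "cinner x (E x) = 0"
      using that QE by (simp add: orth_compl_def ker) (simp add: op_kernel_def)
    then have "E x \<bullet> E x = 0"
      using inner_eq_0_if_cinner_eq_0 [of x "E x"] by (simp add: E_sa E_ker QE)
    then show ?thesis
      by (simp add: norm_V)
  qed
  then have "partial_isometry V"
    by (simp add: partial_isometry_def V)
  moreover have "closure (range T) \<subseteq> V ` closure (range (abs_op T))"
  proof
    fix w assume "w \<in> closure (range T)"
    then obtain X where "\<forall>k. X k \<in> range T" and X: "X \<longlonglongrightarrow> w"
      unfolding closure_sequential by blast
    then have "\<forall>k. \<exists>x. X k = T x"
      by blast
    then obtain x where "\<forall>k. X k = T (x k)"
      by (rule choice [THEN exE])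
    then have x: "X = (\<lambda>k. T (x k))"
      by auto
    \<comment> \<open>Equal norms transfer the Cauchy property from T to |T|, which gives a preimage
      in the closure of Ran |T|.\<close>
    have "dist (abs_op T (x k)) (abs_op T (x m)) = dist (X k) (X m)" for k m
      unfolding dist_norm x T.diff [symmetric] norm_abs_op
      by (simp add: linear_diff [OF bounded_linear.linear [OF psdD(1) [OF psd_abs_op]]])
    then have "Cauchy (\<lambda>k. abs_op T (x k))"
      using LIMSEQ_imp_Cauchy [OF X] by (simp add: Cauchy_def)
    then obtain m where m: "(\<lambda>k. abs_op T (x k)) \<longlonglongrightarrow> m"
      by (auto simp: Cauchy_convergent_iff convergent_def)
    then have "m \<in> closure (range (abs_op T))"
      unfolding closure_sequential by (intro exI [of _ "\<lambda>k. abs_op T (x k)"]) simp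
    moreover have "V m = w"
    proof (rule LIMSEQ_unique)
      show "X \<longlonglongrightarrow> V m"
        using bounded_linear.tendsto [OF blV m] by (simp add: VQ x)
    qed (rule X)
    ultimately show "w \<in> V ` closure (range (abs_op T))"
      by blast
  qed
  ultimately have "polar_decomposition T V (abs_op T)"
    unfolding polar_decomposition_def
    using VQ V_ran positive_abs_op [OF T] ker orth_compl_range_abs_op by auto
  then show thesis
    by (rule that [OF _ V E VQ norm_V V_ran QE E_ker E_sa V_comm E_comm])
qed

text \<open>Ran Q is orthogonal to the kernel of \<open>U\<close>, so \<open>U\<close> is isometric
  there and T and Q have equal norms at every vector. Polarisation turns this into
  \<open>Q (Q x) = adj T (T x)\<close>.\<close>

lemma polar_decomposition_unique:
  assumes polar: "polar_decomposition T U Q"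
  shows "Q = abs_op T"
proof (rule abs_op_unique [OF T])
  show Q: "positive_op Q"
    using polar by (simp add: polar_decomposition_def)
  have "Q x \<in> orth_compl (op_kernel U)" for x
  proof -
    have "Q x \<in> closure (range Q)"
      by (rule subsetD [OF closure_subset rangeI])
    then have "cinner y (Q x) = 0" if "y \<in> op_kernel U" for y
      using that polar by (simp add: polar_decomposition_def orth_compl_def)
    then show ?thesis
      by (simp add: orth_compl_def cinner_eq_0_commute [of "Q x"])
  qed
  then have norm_eq: "norm (T x) = norm (Q x)" for x
    using polar by (auto simp: polar_decomposition_def partial_isometry_def)
  note sa = psdD(2) [OF positive_op_psd [OF Q]]
  note blQ = psdD(1) [OF positive_op_psd [OF Q]]
  show "Q (Q x) = adj T (T x)" for x
  proof (rule vector_eq_ldot [THEN iffD1, rule_format])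
    show "z \<bullet> Q (Q x) = z \<bullet> adj T (T x)" for z
      using inner_eq_if_norm_eq [OF T.bounded_linear blQ norm_eq, of z x]
      by (simp add: inner_adj [OF T] sa)
  qed
qed

text \<open>With Q = |T|, \<open>adj T\<close> is Q followed on the right by \<open>adj U\<close>;
  moving U past both factors Q reduces \<open>T (adj T y)\<close> to Q(Qy) through
  \<open>U (adj U y) = y\<close>.\<close>

lemma unitary_commute_imp_normal:
  assumes U: "unitary_op U" and TU: "T = U \<circ> abs_op T" and comm: "abs_op T \<circ> U = U \<circ> abs_op T"
  shows "normal_op T"
proof -
  have blU: "bounded_op U" and UU: "\<And>x. U (adj U x) = x"
    using U by (auto simp: unitary_op_def fun_eq_iff)
  have T_eq: "T x = U (abs_op T x)" for x
    using TU by (metis comp_apply)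
  have adj_T: "adj T y = abs_op T (adj U y)" for y
  proof (rule vector_eq_ldot [THEN iffD1, rule_format])
    fix z
    have "z \<bullet> adj T y = U (abs_op T z) \<bullet> y"
      by (simp add: inner_adj [OF T, symmetric] T_eq [symmetric])
    then show "z \<bullet> adj T y = z \<bullet> abs_op T (adj U y)"
      by (simp add: inner_adj [OF blU] psdD(2) [OF psd_abs_op])
  qed
  have "T (adj T y) = adj T (T y)" for y
  proof -
    have "abs_op T (U x) = U (abs_op T x)" for x
      using comm by (simp add: fun_eq_iff)
    then have "T (adj T y) = abs_op T (abs_op T (U (adj U y)))"
      by (simp add: T_eq adj_T)
    then show ?thesis
      by (simp add: UU abs_op_square [OF T])
  qed
  then show ?thesis
    by (simp add: normal_op_def T fun_eq_iff)
qed

end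

section \<open>Normal operators\<close>

context
  fixes T :: "('h::{real_inner,complete_space}, 'n::{finite,linorder}) clifford_op"
  assumes normal: "normal_op T"
begin

lemma normal_bounded_op: "bounded_op T"
  using normal by (simp add: normal_op_def)

lemma normal_commute: "T (adj T x) = adj T (T x)"
  using normal by (simp add: normal_op_def fun_eq_iff)

lemma normal_abs_op_commute: "T (abs_op T x) = abs_op T (T x)"
  by (rule abs_op_commute [OF normal_bounded_op bounded_opD(1) [OF normal_bounded_op]])
    (simp add: normal_commute)

text \<open>On Ran |T| the claim is that T commutes with |T|; on the kernel of |T|, which is also
  that of \<open>U\<close>, both sides vanish.\<close>

lemma normal_polar_commute:
  assumes polar: "polar_decomposition T U (abs_op T)"
  shows "abs_op T \<circ> U = U \<circ> abs_op T"
proof (rule eq_if_agree_range_kernel [OF psd_abs_op [OF normal_bounded_op]])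
  have U: "bounded_op U" and T_eq: "\<And>x. U (abs_op T x) = T x"
    using polar by (auto simp: polar_decomposition_def partial_isometry_def fun_eq_iff)
  note Q = bounded_abs_op [OF normal_bounded_op]
  show "bounded_linear (abs_op T \<circ> U)" "bounded_linear (U \<circ> abs_op T)"
    by (intro bounded_opD(1) bounded_op_comp U Q)+
  show "(abs_op T \<circ> U) (abs_op T x) = (U \<circ> abs_op T) (abs_op T x)" for x
    by (simp add: T_eq normal_abs_op_commute)
  show "(abs_op T \<circ> U) x = (U \<circ> abs_op T) x" if x: "abs_op T x = 0" for x
  proof -
    have "x \<in> op_kernel U"
      using polar x unfolding polar_decomposition_def orth_compl_range_abs_op [OF normal_bounded_op]
      by (simp add: op_kernel_def)
    then show ?thesis
      using x by (simp add: op_kernel_def linear_0 [OF bounded_linear.linear] bounded_opD(1) U Q)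
  qed
qed

text \<open>Here \<open>U\<close> is an arbitrary unitary factor, so no limit construction is
  available for it. Instead \<open>adj T (U y) = abs_op T y\<close> and normality show that it
  commutes with \<open>adj T \<circ> T\<close>, hence with the root.\<close>

lemma normal_unitary_commute:
  assumes U: "unitary_op U" and TU: "T = U \<circ> abs_op T"
  shows "abs_op T \<circ> U = U \<circ> abs_op T"
proof -
  have blU: "bounded_op U" and UU: "\<And>x. adj U (U x) = x"
    using U by (auto simp: unitary_op_def fun_eq_iff)
  note T = normal_bounded_op
  have T_eq: "T x = U (abs_op T x)" for x
    using TU by (metis comp_apply)
  have adj_T: "adj T (U y) = abs_op T y" for y
  proof (rule vector_eq_ldot [THEN iffD1, rule_format])
    fix z
    have "z \<bullet> adj T (U y) = U (abs_op T z) \<bullet> U y"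
      by (simp add: inner_adj [OF T, symmetric] T_eq [symmetric])
    then show "z \<bullet> adj T (U y) = z \<bullet> abs_op T y"
      by (simp add: inner_adj [OF blU] UU psdD(2) [OF psd_abs_op [OF T]])
  qed
  have "U (adj T (T x)) = adj T (T (U x))" for x
  proof -
    have "U (adj T (T x)) = T (abs_op T x)"
      by (simp add: T_eq [of "abs_op T x"] abs_op_square [OF T])
    also have "\<dots> = adj T (T (U x))"
      by (simp add: adj_T [symmetric] normal_commute)
    finally show ?thesis .
  qed
  then show ?thesis
    using abs_op_commute [OF T bounded_opD(1) [OF blU]] by (simp add: fun_eq_iff)
qed

text \<open>
  The unitary factor is \<open>U = V + E\<close> with \<open>V\<close> the partial isometry and \<open>E\<close> the projection onto the
  kernel of \<open>|T|\<close>.  It is isometric because normality makes \<open>Ran T\<close> orthogonal to that kernel.  It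
  commutes with everything commuting with \<open>T\<close> and \<open>T\<^sup>*\<close>, first with \<open>T\<close> and \<open>T\<^sup>*\<close> themselves, then with
  \<open>U\<^sup>*\<close>; so \<open>U U\<^sup>* = U\<^sup>* U = I\<close>.
\<close>

lemma normal_unitary_obtain:
  obtains U where "unitary_op U" and "T = U \<circ> abs_op T"
    and "\<And>W x. bounded_op W \<Longrightarrow> (\<And>y. W (T y) = T (W y)) \<Longrightarrow> (\<And>y. W (adj T y) = adj T (W y)) \<Longrightarrow>
      W (U x) = U (W x)"
proof (rule polar_decomposition_obtain [OF normal_bounded_op])
  fix V E
  assume V: "bounded_op V" and E: "bounded_op E" and VQ: "\<And>x. V (abs_op T x) = T x"
    and norm_V: "\<And>x. norm (V x) = norm (x - E x)" and V_ran: "\<And>x. V x \<in> closure (range T)"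
    and QE: "\<And>x. abs_op T (E x) = 0" and E_ker: "\<And>x. abs_op T x = 0 \<Longrightarrow> E x = x"
    and E_sa: "\<And>x y. E x \<bullet> y = x \<bullet> E y"
    and V_comm: "\<And>W x. bounded_linear W \<Longrightarrow> (\<And>y. W (T y) = T (W y)) \<Longrightarrow>
        (\<And>y. W (abs_op T y) = abs_op T (W y)) \<Longrightarrow> W (V x) = V (W x)"
    and E_comm: "\<And>W x. bounded_linear W \<Longrightarrow> (\<And>y. W (abs_op T y) = abs_op T (W y)) \<Longrightarrow>
        W (E x) = E (W x)"
  note T = normal_bounded_op
  define U where "U x = V x + E x" for x
  have U: "bounded_op U"
    unfolding bounded_op_def U_def
    by (simp add: bounded_linear_add bounded_opD [OF V] bounded_opD [OF E] right_mult_add_left)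
  have "norm (U x) = norm x" for x
  proof -
    have "norm (T (E x)) = 0"
      by (simp add: norm_abs_op [OF T] QE)
    \<comment> \<open>Normality: the kernel of T lies in that of \<open>adj T\<close>, the
      orthogonal complement of Ran T.\<close>
    then have "adj T (E x) \<bullet> adj T (E x) = 0"
      by (simp add: inner_adj_left [OF T] normal_commute
          linear_0 [OF bounded_linear.linear [OF bounded_opD(1) [OF bounded_op_adj [OF T]]]])
    then have "E x \<bullet> T z = 0" for z
      by (simp add: inner_adj_left [OF T, symmetric])
    then have "E x \<bullet> V x = 0"
      using V_ran by (rule inner_closure_range_eq_0)
    then have "(norm (U x))\<^sup>2 = (norm (V x))\<^sup>2 + (norm (E x))\<^sup>2"
      by (simp add: U_def power2_norm_eq_inner inner_add_left inner_add_right inner_commute)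
    also have "\<dots> = (norm x)\<^sup>2"
    proof -
      have "E x \<bullet> E x = x \<bullet> E x"
        by (simp add: E_sa E_ker QE)
      then show ?thesis
        by (simp add: norm_V power2_norm_eq_inner inner_diff_left inner_diff_right inner_commute)
    qed
    finally show ?thesis
      by simp
  qed
  then have iso: "U x \<bullet> U y = x \<bullet> y" for x y
    using inner_eq_if_norm_eq [OF bounded_opD(1) [OF U] bounded_linear_ident] by simp
  have UU: "adj U (U x) = x" for x
    by (rule vector_eq_ldot [THEN iffD1, rule_format]) (simp add: inner_adj [OF U, symmetric] iso)
  have U_comm: "W (U x) = U (W x)"
    if W: "bounded_op W" "\<And>y. W (T y) = T (W y)" "\<And>y. W (adj T y) = adj T (W y)" for W x
  proof -
    note blW = bounded_opD(1) [OF W(1)]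
    have Q: "W (abs_op T y) = abs_op T (W y)" for y
      by (rule abs_op_commute [OF T blW]) (simp add: W)
    show ?thesis
      by (simp add: U_def linear_simps(1) [OF blW] V_comm [OF blW W(2) Q] E_comm [OF blW Q])
  qed
  have UT: "U (T x) = T (U x)" for x
    using U_comm [OF T] normal_commute by simp
  have UT': "U (adj T x) = adj T (U x)" for x
    using U_comm [OF bounded_op_adj [OF T]] normal_commute by simp
  have "adj U (U x) = U (adj U x)" for x
    by (rule U_comm [OF bounded_op_adj [OF U]])
      (rule adj_commute [OF U T UT'], rule adj_commute_adj [OF U T UT])
  then have "unitary_op U"
    using UU by (simp add: unitary_op_def U fun_eq_iff)
  \<comment> \<open>\<open>E\<close> commutes with |T| and |T| annihilates the range of
    \<open>E\<close>, so adding \<open>E\<close> to \<open>V\<close> changes nothing on Ran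
    |T|.\<close>
  moreover have "T x = U (abs_op T x)" for x
    using E_comm [OF psdD(1) [OF psd_abs_op [OF T]], of x]
    by (simp add: U_def VQ QE)
  then have "T = U \<circ> abs_op T"
    by auto
  ultimately show thesis
    using U_comm by (rule that)
qed

end

text \<open>A non-normal T may have no unitary factor, so the closing equivalence appears for each
  given unitary factor and also as an existence statement.\<close>

theorem theorem7p0p1:
  fixes T :: "('h::{real_inner,complete_space}, 'n::{finite,linorder}) clifford_op"
  assumes "bounded_op T"
  shows
    "(\<exists>!Q. positive_op Q \<and> Q \<circ> Q = adj T \<circ> T) \<and>
     (\<exists>U. polar_decomposition T U (abs_op T)) \<and>
     (\<forall>U Q. polar_decomposition T U Q \<longrightarrow> Q = abs_op T) \<and>
     (normal_op T \<longrightarrow>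
       (\<exists>U. unitary_op U \<and> T = U \<circ> abs_op T \<and>
         (\<forall>W. bounded_op W \<longrightarrow>
           W \<circ> T = T \<circ> W \<and> W \<circ> adj T = adj T \<circ> W \<longrightarrow> W \<circ> abs_op T = abs_op T \<circ> W) \<and>
         (\<forall>W. bounded_op W \<longrightarrow>
           W \<circ> T = T \<circ> W \<and> W \<circ> adj T = adj T \<circ> W \<longrightarrow> W \<circ> U = U \<circ> W))) \<and>
     (\<forall>U. polar_decomposition T U (abs_op T) \<longrightarrow>
       normal_op T \<longrightarrow> abs_op T \<circ> U = U \<circ> abs_op T) \<and>
     (\<forall>U. unitary_op U \<and> T = U \<circ> abs_op T \<longrightarrow>
       (normal_op T \<longleftrightarrow> abs_op T \<circ> U = U \<circ> abs_op T)) \<and>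
     (normal_op T \<longleftrightarrow>
       (\<exists>U. unitary_op U \<and> T = U \<circ> abs_op T \<and> abs_op T \<circ> U = U \<circ> abs_op T))"
proof (intro conjI)
  note T = assms
  show "\<exists>!Q. positive_op Q \<and> Q \<circ> Q = adj T \<circ> T"
    by (rule abs_op_ex1 [OF T])
  show "\<exists>U. polar_decomposition T U (abs_op T)"
    by (rule polar_decomposition_obtain [OF T]) blast
  show "\<forall>U Q. polar_decomposition T U Q \<longrightarrow> Q = abs_op T"
    using polar_decomposition_unique [OF T] by blast
  have comm: "W \<circ> abs_op T = abs_op T \<circ> W"
    if "bounded_op W" "W \<circ> T = T \<circ> W \<and> W \<circ> adj T = adj T \<circ> W" for W
    using abs_op_commute [OF T bounded_opD(1) [OF that(1)]] that(2) by (simp add: fun_eq_iff)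
  have unitary: "\<exists>U. unitary_op U \<and> T = U \<circ> abs_op T \<and>
      (\<forall>W. bounded_op W \<longrightarrow> W \<circ> T = T \<circ> W \<and> W \<circ> adj T = adj T \<circ> W \<longrightarrow> W \<circ> U = U \<circ> W)"
    if "normal_op T"
  proof (rule normal_unitary_obtain [OF that])
    fix U
    assume "unitary_op U" "T = U \<circ> abs_op T"
      and "\<And>W x. bounded_op W \<Longrightarrow> (\<And>y. W (T y) = T (W y)) \<Longrightarrow>
        (\<And>y. W (adj T y) = adj T (W y)) \<Longrightarrow> W (U x) = U (W x)"
    then show ?thesis
      by (intro exI [of _ U] conjI allI impI) (simp_all add: fun_eq_iff)
  qed
  show "normal_op T \<longrightarrow>
      (\<exists>U. unitary_op U \<and> T = U \<circ> abs_op T \<and>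
        (\<forall>W. bounded_op W \<longrightarrow>
          W \<circ> T = T \<circ> W \<and> W \<circ> adj T = adj T \<circ> W \<longrightarrow> W \<circ> abs_op T = abs_op T \<circ> W) \<and>
        (\<forall>W. bounded_op W \<longrightarrow>
          W \<circ> T = T \<circ> W \<and> W \<circ> adj T = adj T \<circ> W \<longrightarrow> W \<circ> U = U \<circ> W))"
    using unitary comm by blast
  show "\<forall>U. polar_decomposition T U (abs_op T) \<longrightarrow>
      normal_op T \<longrightarrow> abs_op T \<circ> U = U \<circ> abs_op T"
    using normal_polar_commute by blast
  show iff: "\<forall>U. unitary_op U \<and> T = U \<circ> abs_op T \<longrightarrow>
      (normal_op T \<longleftrightarrow> abs_op T \<circ> U = U \<circ> abs_op T)"
    using normal_unitary_commute unitary_commute_imp_normal [OF T] by blast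
  show "normal_op T \<longleftrightarrow>
      (\<exists>U. unitary_op U \<and> T = U \<circ> abs_op T \<and> abs_op T \<circ> U = U \<circ> abs_op T)"
    using unitary iff by blast
qed

end
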